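(* Let $\mathcal{H}$ be a finite-dimensional Hilbert space and $\tau$ a quantum channel on $\mathcal{H}$ having a faithful (full-rank) fixed point $\rho_*\in\mathcal{S}(\mathcal{H})$. Then $\tau$ is mixing if and only if the function $S:\mathcal{S}(\mathcal{H})\to\mathbb{R}$, $S(\rho)=H(\rho,\rho_* )\equiv\mathrm{Tr}\,\rho(\log\rho-\log\rho_* )$, is a generalised Lyapunov function for $\tau$ around $\rho_*$.
   Context: $\mathcal{S}(\mathcal{H})$ is the set of density matrices on $\mathcal{H}$ with the trace-norm topology. A quantum channel is a linear, completely positive, trace-preserving map on the operators of $\mathcal{H}$, considered as a map $\mathcal{S}(\mathcal{H})\to\mathcal{S}(\mathcal{H})$. $\tau$ is mixing if there is $\rho_0\in\mathcal{S}(\mathcal{H})$ with $\tau^n(\rho)\to\rho_0$ for all $\rho\in\mathcal{S}(\mathcal{H})$. A continuous $S:\mathcal{S}(\mathcal{H})\to\mathbb{R}$ is a generalised Lyapunov function for $\tau$ around $\rho_*$ if for each $\rho$ the sequence $S(\tau^n(\rho))$ converges and $\lim_n S(\tau^n(\rho))\neq S(\rho)$ for all $\rho\neq\rho_*$. The convention $0\log0=0$ is used. *)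

theory Defs
  imports Complex_Main "Jordan_Normal_Form.Determinant"
begin

text \<open>Finite-dimensional Hilbert space H = C^n; operators on H are n x n complex matrices.\<close>

definition mtrace :: "complex mat \<Rightarrow> complex" where
  "mtrace A = (\<Sum>i<dim_row A. A $$ (i, i))"

definition adj :: "complex mat \<Rightarrow> complex mat" where
  "adj A = mat (dim_col A) (dim_row A) (\<lambda>(i, j). cnj (A $$ (j, i)))"

definition cinner :: "complex vec \<Rightarrow> complex vec \<Rightarrow> complex" where
  "cinner v w = (\<Sum>i<dim_vec v. cnj (v $ i) * w $ i)"

definition psd :: "nat \<Rightarrow> complex mat \<Rightarrow> bool" where
  "psd n A \<longleftrightarrow> A \<in> carrier_mat n n \<and>
     (\<forall>v \<in> carrier_vec n. \<exists>r::real. r \<ge> 0 \<and> cinner v (A *\<^sub>v v) = complex_of_real r)"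

definition density :: "nat \<Rightarrow> complex mat set" where
  "density n = {\<rho>. psd n \<rho> \<and> mtrace \<rho> = 1}"

definition unitary :: "nat \<Rightarrow> complex mat \<Rightarrow> bool" where
  "unitary n U \<longleftrightarrow> U \<in> carrier_mat n n \<and> U * adj U = 1\<^sub>m n"

definition rdiag :: "nat \<Rightarrow> (nat \<Rightarrow> real) \<Rightarrow> complex mat" where
  "rdiag n d = mat n n (\<lambda>(i, j). if i = j then complex_of_real (d i) else 0)"

definition mat_fun :: "nat \<Rightarrow> (real \<Rightarrow> real) \<Rightarrow> complex mat \<Rightarrow> complex mat" where
  "mat_fun n f A = (SOME B. \<exists>U d. unitary n U \<and> A = U * rdiag n d * adj U \<and>
                                   B = U * rdiag n (f \<circ> d) * adj U)"

definition trace_norm :: "nat \<Rightarrow> complex mat \<Rightarrow> real" where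
  "trace_norm n A = Re (mtrace (mat_fun n sqrt (adj A * A)))"

text \<open>Relative entropy H(rho, sigma) = Tr rho (log rho - log sigma), with 0 log 0 = 0,
  i.e. Tr (rho log rho) - Tr (rho log sigma) where rho log rho = f(rho), f(x) = x ln x.\<close>
definition rel_entropy :: "nat \<Rightarrow> complex mat \<Rightarrow> complex mat \<Rightarrow> real" where
  "rel_entropy n \<rho> \<sigma> =
     Re (mtrace (mat_fun n (\<lambda>x. if x = 0 then 0 else x * ln x) \<rho>) - mtrace (\<rho> * mat_fun n ln \<sigma>))"

definition block_mat :: "nat \<Rightarrow> nat \<Rightarrow> (nat \<Rightarrow> nat \<Rightarrow> complex mat) \<Rightarrow> complex mat" where
  "block_mat k n M = mat (k * n) (k * n) (\<lambda>(a, b). M (a div n) (b div n) $$ (a mod n, b mod n))"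

definition quantum_channel :: "nat \<Rightarrow> (complex mat \<Rightarrow> complex mat) \<Rightarrow> bool" where
  "quantum_channel n \<tau> \<longleftrightarrow>
     (\<forall>A \<in> carrier_mat n n. \<tau> A \<in> carrier_mat n n) \<and>
     (\<forall>A \<in> carrier_mat n n. \<forall>B \<in> carrier_mat n n. \<tau> (A + B) = \<tau> A + \<tau> B) \<and>
     (\<forall>A \<in> carrier_mat n n. \<forall>c. \<tau> (c \<cdot>\<^sub>m A) = c \<cdot>\<^sub>m \<tau> A) \<and>
     (\<forall>A \<in> carrier_mat n n. mtrace (\<tau> A) = mtrace A) \<and>
     (\<forall>k M. (\<forall>i<k. \<forall>j<k. M i j \<in> carrier_mat n n) \<longrightarrow> psd (k * n) (block_mat k n M) \<longrightarrow>
            psd (k * n) (block_mat k n (\<lambda>i j. \<tau> (M i j))))"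

definition mixing :: "nat \<Rightarrow> (complex mat \<Rightarrow> complex mat) \<Rightarrow> bool" where
  "mixing n \<tau> \<longleftrightarrow> (\<exists>\<rho>0 \<in> density n. \<forall>\<rho> \<in> density n.
      (\<lambda>m. trace_norm n ((\<tau> ^^ m) \<rho> - \<rho>0)) \<longlonglongrightarrow> 0)"

definition tn_continuous_on :: "nat \<Rightarrow> (complex mat \<Rightarrow> real) \<Rightarrow> bool" where
  "tn_continuous_on n S \<longleftrightarrow> (\<forall>\<rho> \<in> density n. \<forall>e>0. \<exists>d>0. \<forall>\<sigma> \<in> density n.
      trace_norm n (\<sigma> - \<rho>) < d \<longrightarrow> \<bar>S \<sigma> - S \<rho>\<bar> < e)"

definition gen_lyapunov :: "nat \<Rightarrow> (complex mat \<Rightarrow> complex mat) \<Rightarrow> (complex mat \<Rightarrow> real) \<Rightarrow> complex mat \<Rightarrow> bool" where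
  "gen_lyapunov n \<tau> S \<rho>s \<longleftrightarrow> tn_continuous_on n S \<and>
     (\<forall>\<rho> \<in> density n. convergent (\<lambda>m. S ((\<tau> ^^ m) \<rho>))) \<and>
     (\<forall>\<rho> \<in> density n. \<rho> \<noteq> \<rho>s \<longrightarrow> lim (\<lambda>m. S ((\<tau> ^^ m) \<rho>)) \<noteq> S \<rho>)"

end

theory Submission
  imports Defs "Jordan_Normal_Form.Spectral_Radius" "HOL-Analysis.Weierstrass_Theorems"
begin

text \<open>Write \<open>S \<rho> = H(\<rho>, \<rho>s)\<close>. It is continuous on density matrices: \<open>Tr f(\<rho>)\<close> with \<open>f x = x ln x\<close> is a
  uniform limit of functions \<open>Tr p(\<rho>)\<close> with \<open>p\<close> a polynomial approximating \<open>f\<close> on \<open>[0,1]\<close>. By the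
  equality case of Klein's inequality it vanishes only at \<open>\<rho>s\<close>. If \<open>\<tau>\<close> is mixing, every orbit tends to
  the fixed point \<open>\<rho>s\<close>, hence \<open>S\<close> tends to \<open>0\<close> along it, which differs from the initial value unless
  the orbit starts at \<open>\<rho>s\<close>. Conversely, if \<open>A\<close> is a limit point of an orbit and \<open>L\<close> the limit of \<open>S\<close>
  along it, then \<open>S (\<tau>\<^sup>k A) = L\<close> for every \<open>k\<close>, so the Lyapunov property forces \<open>A = \<rho>s\<close>; compactness of
  the set of density matrices turns this into convergence.\<close>

hide_const (open) Finite_Cartesian_Product.mat Finite_Cartesian_Product.vec
hide_type (open) Finite_Cartesian_Product.vec
unbundle no vec_syntax

subsection \<open>Matrices, adjoints and unitaries\<close>

lemma adj_carrier [simp]: "A \<in> carrier_mat n m \<Longrightarrow> adj A \<in> carrier_mat m n"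
  by (auto simp: adj_def)

lemma adj_index [simp]: "i < dim_col A \<Longrightarrow> j < dim_row A \<Longrightarrow> adj A $$ (i, j) = cnj (A $$ (j, i))"
  by (simp add: adj_def)

lemma dim_adj [simp]: "dim_row (adj A) = dim_col A" "dim_col (adj A) = dim_row A"
  by (auto simp: adj_def)

lemma adj_adj [simp]: "adj (adj A) = A"
  by (rule eq_matI) auto

lemma rdiag_carrier [simp]: "rdiag n d \<in> carrier_mat n n"
  by (simp add: rdiag_def)

lemma dim_rdiag [simp]: "dim_row (rdiag n d) = n" "dim_col (rdiag n d) = n"
  by (auto simp: rdiag_def)

lemma rdiag_index [simp]:
  "i < n \<Longrightarrow> j < n \<Longrightarrow> rdiag n d $$ (i, j) = (if i = j then complex_of_real (d i) else 0)"
  by (simp add: rdiag_def)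

lemma mat_mult_entry:
  assumes "A \<in> carrier_mat n m" "B \<in> carrier_mat m l" "i < n" "j < l"
  shows "(A * B) $$ (i, j) = (\<Sum>k<m. A $$ (i, k) * B $$ (k, j))"
  using assms by (auto simp: scalar_prod_def atLeast0LessThan intro!: sum.cong)

lemma mat_vec_entry:
  assumes "A \<in> carrier_mat n m" "v \<in> carrier_vec m" "i < n"
  shows "(A *\<^sub>v v) $ i = (\<Sum>k<m. A $$ (i, k) * v $ k)"
  using assms by (auto simp: scalar_prod_def atLeast0LessThan intro!: sum.cong)

lemma mult_carrier_square [simp]:
  "A \<in> carrier_mat n n \<Longrightarrow> B \<in> carrier_mat n n \<Longrightarrow> A * B \<in> carrier_mat n n"
  by (rule mult_carrier_mat)

lemma assoc_mult_square:
  "A \<in> carrier_mat n n \<Longrightarrow> B \<in> carrier_mat n n \<Longrightarrow> C \<in> carrier_mat n n \<Longrightarrow>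
    A * B * C = A * (B * C)"
  by (rule assoc_mult_mat)

lemma adj_mult:
  assumes "A \<in> carrier_mat n m" "B \<in> carrier_mat m l"
  shows "adj (A * B) = adj B * adj A"
proof (rule eq_matI)
  fix i j assume "i < dim_row (adj B * adj A)" "j < dim_col (adj B * adj A)"
  with assms have ij: "i < l" "j < n" by auto
  have "adj (A * B) $$ (i, j) = cnj ((A * B) $$ (j, i))"
    using assms ij by simp
  also have "\<dots> = (\<Sum>k<m. cnj (A $$ (j, k)) * cnj (B $$ (k, i)))"
    using mat_mult_entry[OF assms ij(2,1)] by simp
  also have "\<dots> = (\<Sum>k<m. adj B $$ (i, k) * adj A $$ (k, j))"
    using assms ij by (intro sum.cong) auto
  also have "\<dots> = (adj B * adj A) $$ (i, j)"
    using mat_mult_entry[OF adj_carrier[OF assms(2)] adj_carrier[OF assms(1)] ij] by simp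
  finally show "adj (A * B) $$ (i, j) = (adj B * adj A) $$ (i, j)" .
qed (use assms in auto)

text \<open>For square matrices a right inverse is also a left inverse; this gives the second
  identity, which the definition of \<open>unitary\<close> does not state.\<close>

lemma unitaryD:
  assumes "unitary n U"
  shows "U \<in> carrier_mat n n" "U * adj U = 1\<^sub>m n" "adj U * U = 1\<^sub>m n"
proof -
  show U: "U \<in> carrier_mat n n" and 1: "U * adj U = 1\<^sub>m n"
    using assms by (simp_all add: unitary_def)
  show "adj U * U = 1\<^sub>m n"
    by (rule mat_mult_left_right_inverse[OF U adj_carrier[OF U] 1])
qed

lemma unitary_mult:
  assumes "unitary n U" "unitary n V"
  shows "unitary n (U * V)"
proof -
  note U = unitaryD[OF assms(1)] and V = unitaryD[OF assms(2)]
  have "U * V * adj (U * V) = U * V * (adj V * adj U)"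
    using adj_mult[OF U(1) V(1)] by simp
  also have "\<dots> = U * (V * adj V) * adj U"
    using U(1) V(1) by (simp add: assoc_mult_square[of _ n])
  also have "\<dots> = 1\<^sub>m n" using U V by simp
  finally show ?thesis using U V by (auto simp: unitary_def)
qed

lemma unitary_adj: "unitary n U \<Longrightarrow> unitary n (adj U)"
  by (frule unitaryD(1), drule unitaryD(3)) (simp add: unitary_def)

lemma rdiag_mult_left:
  assumes "A \<in> carrier_mat n m" "i < n" "j < m"
  shows "(rdiag n d * A) $$ (i, j) = of_real (d i) * A $$ (i, j)"
proof -
  have "(rdiag n d * A) $$ (i, j) = (\<Sum>k<n. if k = i then of_real (d i) * A $$ (i, j) else 0)"
    unfolding mat_mult_entry[OF rdiag_carrier assms] using assms by (intro sum.cong) auto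
  then show ?thesis using assms by simp
qed

lemma rdiag_mult_right:
  assumes "A \<in> carrier_mat m n" "i < m" "j < n"
  shows "(A * rdiag n d) $$ (i, j) = of_real (d j) * A $$ (i, j)"
proof -
  have "(A * rdiag n d) $$ (i, j) = (\<Sum>k<n. if k = j then of_real (d j) * A $$ (i, j) else 0)"
    unfolding mat_mult_entry[OF assms(1) rdiag_carrier assms(2,3)]
    using assms by (intro sum.cong) auto
  then show ?thesis using assms by simp
qed

lemma mtrace_mult_commute:
  assumes "A \<in> carrier_mat n m" "B \<in> carrier_mat m n"
  shows "mtrace (A * B) = mtrace (B * A)"
proof -
  have "mtrace (A * B) = (\<Sum>i<n. \<Sum>k<m. A $$ (i, k) * B $$ (k, i))"
    using assms mat_mult_entry[OF assms] by (auto simp: mtrace_def intro!: sum.cong)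
  also have "\<dots> = (\<Sum>k<m. \<Sum>i<n. B $$ (k, i) * A $$ (i, k))"
    by (subst sum.swap) (simp add: mult.commute)
  also have "\<dots> = mtrace (B * A)"
    using assms mat_mult_entry[OF assms(2,1)] by (auto simp: mtrace_def intro!: sum.cong)
  finally show ?thesis .
qed

lemma mtrace_unitary_conj:
  assumes "unitary n U"
  shows "mtrace (U * rdiag n d * adj U) = of_real (\<Sum>i<n. d i)"
proof -
  note U = unitaryD[OF assms]
  have "mtrace (U * rdiag n d * adj U) = mtrace (adj U * (U * rdiag n d))"
    using U by (intro mtrace_mult_commute[of _ n n]) auto
  also have "adj U * (U * rdiag n d) = adj U * U * rdiag n d"
    using U(1) by (simp add: assoc_mult_square[of _ n])
  also have "\<dots> = rdiag n d"
    by (simp add: U left_mult_one_mat[of _ n n])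
  finally show ?thesis by (simp add: mtrace_def)
qed

section \<open>Quadratic forms, Hermitian matrices and Householder reflections\<close>

lemma cinner_mult_mat_vec:
  assumes "A \<in> carrier_mat n n" "v \<in> carrier_vec n"
  shows "cinner v (A *\<^sub>v v) = (\<Sum>i<n. \<Sum>j<n. cnj (v $ i) * A $$ (i, j) * v $ j)"
proof -
  have "cinner v (A *\<^sub>v v) = (\<Sum>i<n. cnj (v $ i) * (A *\<^sub>v v) $ i)"
    using assms by (simp add: cinner_def)
  also have "\<dots> = (\<Sum>i<n. cnj (v $ i) * (\<Sum>j<n. A $$ (i, j) * v $ j))"
    by (intro sum.cong refl) (simp only: lessThan_iff mat_vec_entry[OF assms])
  finally show ?thesis by (simp add: sum_distrib_left mult.assoc)
qed

text \<open>Polarisation: a real quadratic form forces a Hermitian matrix. The form at a basis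
  vector shows that the diagonal is real. The form at \<open>e_i + c e_j\<close> then gives opposite
  imaginary parts of the entries (i, j) and (j, i) for c = 1, and equal real parts for c =
  \<open>\<i>\<close>.\<close>

lemma psd_hermitian:
  assumes "psd n A"
  shows "adj A = A"
proof (rule eq_matI)
  have A: "A \<in> carrier_mat n n" using assms by (simp add: psd_def)
  then show "dim_row (adj A) = dim_row A" "dim_col (adj A) = dim_col A" by auto
  fix i j assume "i < dim_row A" "j < dim_col A"
  with A have ij: "i < n" "j < n" by auto
  have diag: "Im (A $$ (k, k)) = 0" if k: "k < n" for k
  proof -
    have "cinner (unit_vec n k) (A *\<^sub>v unit_vec n k) =
      (\<Sum>p<n. \<Sum>q<n. if q = k then (if p = k then A $$ (k, k) else 0) else 0)"
      unfolding cinner_mult_mat_vec[OF A unit_vec_carrier]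
      using k by (intro sum.cong) auto
    also have "\<dots> = A $$ (k, k)" using k by simp
    finally show ?thesis using assms unit_vec_carrier[of n k] unfolding psd_def
      by (metis Im_complex_of_real)
  qed
  show "adj A $$ (i, j) = A $$ (i, j)"
  proof (cases "i = j")
    case True
    with diag[OF ij(1)] A ij show ?thesis by (auto simp: complex_eq_iff)
  next
    case False
    have pol: "Im (c * A $$ (i, j) + cnj c * A $$ (j, i) + cnj c * c * A $$ (j, j)) = 0" for c
    proof -
      define v where "v = unit_vec n i + c \<cdot>\<^sub>v unit_vec n j"
      have v: "v \<in> carrier_vec n" by (simp add: v_def)
      have vk: "v $ k = (if k = i then 1 else 0) + (if k = j then c else 0)" if "k < n" for k
        using that ij by (auto simp: v_def)
      have row: "(\<Sum>q<n. A $$ (p, q) * v $ q) = A $$ (p, i) + c * A $$ (p, j)" for p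
      proof -
        have "(\<Sum>q<n. A $$ (p, q) * v $ q) =
          (\<Sum>q<n. (if q = i then A $$ (p, i) else 0) + (if q = j then c * A $$ (p, j) else 0))"
          by (intro sum.cong) (auto simp: vk algebra_simps)
        then show ?thesis using ij by (simp add: sum.distrib)
      qed
      have "cinner v (A *\<^sub>v v) = (\<Sum>p<n. cnj (v $ p) * (A $$ (p, i) + c * A $$ (p, j)))"
        unfolding cinner_mult_mat_vec[OF A v] row[symmetric]
        by (simp add: sum_distrib_left mult.assoc)
      also have "\<dots> = (\<Sum>p<n. (if p = i then A $$ (i, i) + c * A $$ (i, j) else 0) +
          (if p = j then cnj c * (A $$ (j, i) + c * A $$ (j, j)) else 0))"
        using False by (intro sum.cong) (auto simp: vk)
      also have "\<dots> = A $$ (i, i) + c * A $$ (i, j) + cnj c * (A $$ (j, i) + c * A $$ (j, j))"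
        using ij by (simp add: sum.distrib)
      finally have "Im (A $$ (i, i) + c * A $$ (i, j) + cnj c * (A $$ (j, i) + c * A $$ (j, j))) = 0"
        using assms v unfolding psd_def by (metis Im_complex_of_real)
      then show ?thesis using diag[OF ij(1)] by (simp add: algebra_simps)
    qed
    from pol[of 1] pol[of \<i>] diag[OF ij(2)] A ij show ?thesis
      by (auto simp: complex_eq_iff)
  qed
qed

text \<open>Completes a unit vector \<open>w\<close> to a unitary matrix having it as first column.
  The reflection along \<open>u = w - e_0\<close> exchanges \<open>e_0\<close> and \<open>w\<close>;
  since \<open>w 0\<close> is real, it is Hermitian and its own inverse.\<close>

lemma householder:
  fixes w :: "nat \<Rightarrow> complex"
  assumes n: "0 < n" and norm: "(\<Sum>i<n. cnj (w i) * w i) = 1" and real: "w 0 \<in> \<real>"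
  shows "\<exists>H. unitary n H \<and> (\<forall>i<n. H $$ (i, 0) = w i)"
proof (cases "w 0 = 1")
  case True
  \<comment> \<open>Here \<open>u\<close> would vanish and there is no reflection, but the unit norm
    leaves nothing for the other entries, so \<open>w\<close> is the first basis vector and the
    identity matrix serves.\<close>
  have "(\<Sum>i\<in>{..<n} - {0}. (cmod (w i))\<^sup>2) = 0"
  proof -
    have "complex_of_real (\<Sum>i<n. (cmod (w i))\<^sup>2) = 1"
      using norm by (simp add: complex_norm_square mult.commute del: of_real_power)
    then have "(\<Sum>i<n. (cmod (w i))\<^sup>2) = 1" by (metis of_real_eq_1_iff)
    then show ?thesis using n True by (simp add: sum.remove[of "{..<n}" 0])
  qed
  then have "w i = 0" if "i < n" "i \<noteq> 0" for i
    using that by (subst (asm) sum_nonneg_eq_0_iff) auto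
  then have "\<forall>i<n. 1\<^sub>m n $$ (i, 0) = w i" using n True by auto
  moreover have "unitary n (1\<^sub>m n)"
  proof -
    have "adj (1\<^sub>m n) = 1\<^sub>m n" by (rule eq_matI) auto
    then show ?thesis by (simp add: unitary_def)
  qed
  ultimately show ?thesis by blast
next
  case False
  define u where "u i = w i - (if i = 0 then 1 else 0)" for i
  define a where "a = 1 - w 0"
  have a: "a \<noteq> 0" "cnj a = a" using False real by (auto simp: a_def Reals_cnj_iff)
  have w0: "cnj (w 0) = w 0" using real by (simp add: Reals_cnj_iff)
  have uu: "(\<Sum>i<n. cnj (u i) * u i) = 2 * a"
  proof -
    have "(\<Sum>i<n. cnj (u i) * u i) = (\<Sum>i<n. cnj (w i) * w i + (if i = 0 then 1 - 2 * w 0 else 0))"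
      by (intro sum.cong) (auto simp: u_def w0 algebra_simps)
    then show ?thesis using n norm by (simp add: sum.distrib a_def)
  qed
  \<comment> \<open>As \<open>2 * a\<close> is the squared norm of \<open>u\<close>, this is the
    usual reflection \<open>1 - 2 u u* / |u|^2\<close>. Its first column is
    \<open>e_0 + u = w\<close> because \<open>u 0 = - a\<close>.\<close>
  define H where "H = mat n n (\<lambda>(i, j). (if i = j then 1 else 0) - u i * cnj (u j) / a)"
  have H: "H \<in> carrier_mat n n" by (simp add: H_def)
  have adjH: "adj H = H" by (rule eq_matI) (auto simp: H_def a)
  have "H * H = 1\<^sub>m n"
  proof (rule eq_matI)
    fix i j assume "i < dim_row (1\<^sub>m n)" "j < dim_col (1\<^sub>m n)"
    then have ij: "i < n" "j < n" by auto
    \<comment> \<open>The summands are grouped so that the Kronecker deltas pick single indices and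
      the last group carries the squared norm \<open>2 * a\<close>, which cancels both copies of
      \<open>u u* / a\<close>.\<close>
    have "(H * H) $$ (i, j) = (\<Sum>k<n. (if k = i then (if i = j then 1 else 0) - u i * cnj (u j) / a else 0)
      - (if k = j then u i * cnj (u j) / a else 0) + (cnj (u k) * u k) * (u i * cnj (u j) / (a * a)))"
      unfolding mat_mult_entry[OF H H ij] using ij
      by (intro sum.cong) (auto simp: H_def field_simps a)
    also have "\<dots> = (if i = j then 1 else 0) - u i * cnj (u j) / a - u i * cnj (u j) / a +
        (2 * a) * (u i * cnj (u j) / (a * a))"
      unfolding sum.distrib sum_subtractf sum_distrib_right[symmetric] uu using ij by simp
    also have "\<dots> = (if i = j then 1 else 0)" using a by (simp add: field_simps)
    finally show "(H * H) $$ (i, j) = 1\<^sub>m n $$ (i, j)" using ij by simp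
  qed (use H in auto)
  then have "unitary n H" using H adjH by (simp add: unitary_def)
  moreover have "H $$ (i, 0) = w i" if "i < n" for i
    using that n a w0 by (auto simp: H_def u_def a_def field_simps)
  ultimately show ?thesis by blast
qed

subsection \<open>The spectral theorem and the trace norm\<close>

text \<open>The direct sum of the scalar \<open>a\<close> and \<open>M\<close>: the shape reached in
  the spectral theorem after splitting off one eigenvector.\<close>

definition bordered :: "nat \<Rightarrow> complex \<Rightarrow> complex mat \<Rightarrow> complex mat" where
  "bordered n a M = mat (Suc n) (Suc n)
    (\<lambda>(i, j). if i = 0 \<or> j = 0 then (if i = j then a else 0) else M $$ (i - 1, j - 1))"

lemma bordered_carrier [simp]: "bordered n a M \<in> carrier_mat (Suc n) (Suc n)"
  by (simp add: bordered_def)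

lemma bordered_index:
  "i < Suc n \<Longrightarrow> j < Suc n \<Longrightarrow> bordered n a M $$ (i, j) =
    (if i = 0 \<or> j = 0 then (if i = j then a else 0) else M $$ (i - 1, j - 1))"
  by (simp add: bordered_def)

lemma bordered_mult:
  assumes M: "M \<in> carrier_mat n n" and N: "N \<in> carrier_mat n n"
  shows "bordered n a M * bordered n b N = bordered n (a * b) (M * N)"
proof (rule eq_matI)
  fix i j assume "i < dim_row (bordered n (a * b) (M * N))" "j < dim_col (bordered n (a * b) (M * N))"
  then have ij: "i < Suc n" "j < Suc n" by (auto simp: bordered_def)
  have "(bordered n a M * bordered n b N) $$ (i, j) =
    bordered n a M $$ (i, 0) * bordered n b N $$ (0, j) +
    (\<Sum>k<n. bordered n a M $$ (i, Suc k) * bordered n b N $$ (Suc k, j))"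
    unfolding mat_mult_entry[OF bordered_carrier bordered_carrier ij] sum.lessThan_Suc_shift ..
  also have "\<dots> = bordered n (a * b) (M * N) $$ (i, j)"
  proof (cases "i = 0 \<or> j = 0")
    case True
    then show ?thesis using ij by (auto simp: bordered_index)
  next
    case False
    then have "i - 1 < n" "j - 1 < n" using ij by auto
    note entry = mat_mult_entry[OF M N this]
    show ?thesis using False ij unfolding bordered_index[OF ij] entry
      by (simp add: bordered_index)
  qed
  finally show "(bordered n a M * bordered n b N) $$ (i, j) = bordered n (a * b) (M * N) $$ (i, j)" .
qed (auto simp: bordered_def)

lemma adj_bordered:
  assumes "M \<in> carrier_mat n n"
  shows "adj (bordered n a M) = bordered n (cnj a) (adj M)"
  by (rule eq_matI) (use assms in \<open>auto simp: bordered_def\<close>)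

lemma bordered_one: "bordered n 1 (1\<^sub>m n) = 1\<^sub>m (Suc n)"
  by (rule eq_matI) (auto simp: bordered_def)

lemma bordered_rdiag: "bordered n (of_real x) (rdiag n d) = rdiag (Suc n) (case_nat x d)"
  by (rule eq_matI) (auto simp: bordered_def split: nat.split)

text \<open>The spectrum of a nonempty complex matrix is nonempty. An eigenvector may be scaled to
  norm one and multiplied by a phase, so that its first entry is real, as \<open>householder\<close>
  demands.\<close>

lemma normalized_eigenvector:
  assumes A: "A \<in> carrier_mat (Suc n) (Suc n)"
  obtains w :: "nat \<Rightarrow> complex" and l
  where "(\<Sum>i<Suc n. cnj (w i) * w i) = 1" "w 0 \<in> \<real>"
    "\<And>i. i < Suc n \<Longrightarrow> (\<Sum>k<Suc n. A $$ (i, k) * w k) = l * w i"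
proof -
  obtain l where "l \<in> spectrum A" using spectrum_non_empty[OF A] by auto
  then obtain v where ev: "eigenvector A v l" by (auto simp: spectrum_def eigenvalue_def)
  then have v: "v \<in> carrier_vec (Suc n)" "v \<noteq> 0\<^sub>v (Suc n)" and Av: "A *\<^sub>v v = l \<cdot>\<^sub>v v"
    using A by (auto simp: eigenvector_def)
  define s where "s = (\<Sum>i<Suc n. (cmod (v $ i))\<^sup>2)"
  \<comment> \<open>The phase that turns \<open>v $ 0\<close> into its modulus; any phase works if
    that entry is zero, and 1 is taken.\<close>
  define ph where "ph = (if v $ 0 = 0 then 1 else cnj (v $ 0) / of_real (cmod (v $ 0)))"
  define w where "w i = ph * v $ i / of_real (sqrt s)" for i
  have "\<exists>i<Suc n. v $ i \<noteq> 0"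
    using v by (metis carrier_vecD eq_vecI index_zero_vec)
  then obtain i where "i < Suc n" "v $ i \<noteq> 0" by blast
  then have s: "s > 0"
    unfolding s_def by (intro sum_pos2[of _ i]) auto
  have ph: "cnj ph * ph = 1"
  proof -
    have "cmod ph = 1" by (simp add: ph_def norm_divide)
    then show ?thesis using complex_norm_square[of ph] by (simp add: mult.commute)
  qed
  have "(\<Sum>i<Suc n. cnj (w i) * w i) = 1"
  proof -
    have ss: "complex_of_real (sqrt s) * complex_of_real (sqrt s) = of_real s"
      using s by (simp flip: of_real_mult)
    have "cnj (w i) * w i = of_real ((cmod (v $ i))\<^sup>2) / of_real s" for i
    proof -
      have "cnj (w i) * w i = (cnj ph * ph) * (v $ i * cnj (v $ i)) /
          (complex_of_real (sqrt s) * complex_of_real (sqrt s))"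
        by (simp add: w_def)
      then show ?thesis unfolding ph ss complex_norm_square by simp
    qed
    then have "(\<Sum>i<Suc n. cnj (w i) * w i) = of_real s / of_real s"
      by (simp only: s_def of_real_sum sum_divide_distrib)
    then show ?thesis using s by simp
  qed
  moreover have "w 0 \<in> \<real>"
  proof (cases "v $ 0 = 0")
    case False
    then have "w 0 = of_real (cmod (v $ 0)) * of_real (cmod (v $ 0)) / of_real (cmod (v $ 0)) / of_real (sqrt s)"
      using complex_norm_square[of "v $ 0"]
      by (simp add: w_def ph_def mult.commute power2_eq_square)
    then show ?thesis by (metis Reals_divide Reals_mult Reals_of_real)
  qed (simp add: w_def)
  moreover have "(\<Sum>k<Suc n. A $$ (i, k) * w k) = l * w i" if i: "i < Suc n" for i
  proof -
    have "(\<Sum>k<Suc n. A $$ (i, k) * w k) = (\<Sum>k<Suc n. A $$ (i, k) * v $ k) * (ph / of_real (sqrt s))"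
      unfolding sum_distrib_right by (intro sum.cong) (auto simp: w_def)
    also have "(\<Sum>k<Suc n. A $$ (i, k) * v $ k) = l * v $ i"
      unfolding mat_vec_entry[OF A v(1) i, symmetric] Av using v i by simp
    finally show ?thesis by (simp add: w_def)
  qed
  ultimately show thesis using that by blast
qed

text \<open>Deflation by induction on the dimension. Conjugating with a unitary whose first column
  is an eigenvector makes the first column of the matrix a multiple of \<open>e_0\<close>;
  Hermiticity then clears the first row, and the remaining block is diagonalised by
  induction.\<close>

theorem spectral_theorem:
  assumes "A \<in> carrier_mat n n" "adj A = A"
  shows "\<exists>U d. unitary n U \<and> A = U * rdiag n d * adj U"
  using assms
proof (induction n arbitrary: A)
  case 0
  have "unitary 0 (1\<^sub>m 0)" by (auto simp: unitary_def)
  moreover have "A = 1\<^sub>m 0 * rdiag 0 (\<lambda>_. 0) * adj (1\<^sub>m 0)"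
    by (rule eq_matI) (use 0 in auto)
  ultimately show ?case by blast
next
  case (Suc n)
  let ?N = "Suc n"
  note A = Suc.prems(1)
  obtain w l where w: "(\<Sum>i<?N. cnj (w i) * w i) = 1" "w 0 \<in> \<real>"
    and Aw: "\<And>i. i < ?N \<Longrightarrow> (\<Sum>k<?N. A $$ (i, k) * w k) = l * w i"
    using normalized_eigenvector[OF A] by blast
  obtain H where H: "unitary ?N H" and Hw: "\<And>i. i < ?N \<Longrightarrow> H $$ (i, 0) = w i"
    using householder[of ?N w] w by auto
  note HD = unitaryD[OF H]
  define B where "B = adj H * (A * H)"
  have B: "B \<in> carrier_mat ?N ?N" using HD(1) A by (simp add: B_def)
  have adjB: "adj B = B"
    using HD(1) A Suc.prems(2)
    by (simp add: B_def adj_mult[of _ ?N ?N _ ?N] assoc_mult_square[of _ ?N])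
  \<comment> \<open>The first column of \<open>A * H\<close> is \<open>l\<close> times that of
    \<open>H\<close>, and \<open>adj H\<close> sends the latter to \<open>e_0\<close>.\<close>
  have col0: "B $$ (i, 0) = (if i = 0 then l else 0)" if i: "i < ?N" for i
  proof -
    have "(A * H) $$ (k, 0) = l * H $$ (k, 0)" if k: "k < ?N" for k
    proof -
      have "(A * H) $$ (k, 0) = (\<Sum>j<?N. A $$ (k, j) * H $$ (j, 0))"
        by (rule mat_mult_entry[OF A HD(1) k zero_less_Suc])
      also have "\<dots> = (\<Sum>j<?N. A $$ (k, j) * w j)" using Hw by (intro sum.cong) auto
      finally show ?thesis using Aw[OF k] Hw[OF k] by simp
    qed
    then have "B $$ (i, 0) = (\<Sum>k<?N. adj H $$ (i, k) * (l * H $$ (k, 0)))"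
      unfolding B_def mat_mult_entry[OF adj_carrier[OF HD(1)] mult_carrier_square[OF A HD(1)] i zero_less_Suc]
      by (intro sum.cong) auto
    also have "\<dots> = l * (\<Sum>k<?N. adj H $$ (i, k) * H $$ (k, 0))"
      unfolding sum_distrib_left by (intro sum.cong) auto
    also have "(\<Sum>k<?N. adj H $$ (i, k) * H $$ (k, 0)) = 1\<^sub>m ?N $$ (i, 0)"
      unfolding mat_mult_entry[OF adj_carrier[OF HD(1)] HD(1) i zero_less_Suc, symmetric] HD(3) ..
    finally show ?thesis using i by simp
  qed
  have herm: "B $$ (i, j) = cnj (B $$ (j, i))" if "i < ?N" "j < ?N" for i j
    using adj_index[of i B j] adjB B that by simp
  \<comment> \<open>The eigenvalue is a diagonal entry of the Hermitian matrix \<open>B\<close>,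
    hence real, as \<open>rdiag\<close> requires.\<close>
  have "Im l = 0" using herm[of 0 0] col0[of 0] by (simp add: complex_eq_iff)
  then have l: "l = of_real (Re l)" by (simp add: complex_eq_iff)
  define A' where "A' = mat n n (\<lambda>(i, j). B $$ (Suc i, Suc j))"
  have A': "A' \<in> carrier_mat n n" by (simp add: A'_def)
  have "adj A' = A'"
    by (rule eq_matI) (auto simp: A'_def herm[symmetric])
  then obtain U' d where U': "unitary n U'" and A'_eq: "A' = U' * rdiag n d * adj U'"
    using Suc.IH[OF A'] by blast
  note UD' = unitaryD[OF U']
  have B_eq: "B = bordered n l A'"
  proof (rule eq_matI)
    fix i j assume "i < dim_row (bordered n l A')" "j < dim_col (bordered n l A')"
    then have ij: "i < ?N" "j < ?N" by (auto simp: bordered_def)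
    then show "B $$ (i, j) = bordered n l A' $$ (i, j)"
      using col0[of i] col0[of j] herm[of i j] by (auto simp: bordered_index A'_def)
  qed (use B in \<open>auto simp: bordered_def\<close>)
  define U1 where "U1 = bordered n 1 U'"
  have U1: "unitary ?N U1"
    using UD' by (simp add: unitary_def U1_def adj_bordered bordered_mult bordered_one)
  have B_eq': "B = U1 * rdiag ?N (case_nat (Re l) d) * adj U1"
    using UD'(1) unfolding B_eq A'_eq U1_def bordered_rdiag[symmetric] l[symmetric]
    by (simp add: adj_bordered bordered_mult)
  have "A = H * B * adj H"
  proof -
    have "H * B * adj H = (H * adj H) * A * (H * adj H)"
      unfolding B_def using HD(1) A by (simp add: assoc_mult_square[of _ ?N])
    then show ?thesis using HD A by simp
  qed
  also have "\<dots> = (H * U1) * rdiag ?N (case_nat (Re l) d) * adj (H * U1)"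
    unfolding B_eq' adj_mult[OF HD(1) unitaryD(1)[OF U1]] using HD(1) unitaryD(1)[OF U1]
    by (simp add: assoc_mult_square[of _ ?N])
  finally show ?case using unitary_mult[OF H U1] by blast
qed

text \<open>The eigenvalue \<open>d i\<close> is the value of the quadratic form of \<open>A\<close>
  at the i-th column of \<open>U\<close>.\<close>

lemma psd_eigenvalue_nonneg:
  assumes A: "psd n A" and U: "unitary n U" and eq: "A = U * rdiag n d * adj U" and i: "i < n"
  shows "0 \<le> d i"
proof -
  note UD = unitaryD[OF U]
  have Ac: "A \<in> carrier_mat n n" using A by (simp add: psd_def)
  have "adj U * (A * U) = (adj U * U) * rdiag n d * (adj U * U)"
    unfolding eq using UD(1) by (simp add: assoc_mult_square[of _ n])
  then have *: "adj U * (A * U) = rdiag n d"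
    using UD by (simp add: right_mult_one_mat[of _ n n] left_mult_one_mat[of _ n n])
  have "cinner (col U i) (A *\<^sub>v col U i) = (\<Sum>k<n. adj U $$ (i, k) * (A * U) $$ (k, i))"
    using UD(1) Ac i by (auto simp: cinner_def col_mult2[of A n n U n] intro!: sum.cong)
  also have "\<dots> = rdiag n d $$ (i, i)"
    unfolding *[symmetric] by (rule mat_mult_entry[symmetric, of _ n n _ n]) (use UD(1) Ac i in auto)
  finally have "cinner (col U i) (A *\<^sub>v col U i) = of_real (d i)" using i by simp
  moreover have "col U i \<in> carrier_vec n" using UD(1) by auto
  ultimately show ?thesis using A unfolding psd_def by (metis of_real_eq_iff)
qed

text \<open>The choice operator in \<open>mat_fun\<close> may pick a different diagonalisation for
  each \<open>f\<close>. Therefore the pair \<open>U\<close>, \<open>d\<close> behind the chosen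
  matrix is handed out together with the facts about it.\<close>

lemma mtrace_mat_fun:
  assumes "psd n A"
  obtains U d where "unitary n U" "A = U * rdiag n d * adj U" "\<And>i. i < n \<Longrightarrow> 0 \<le> d i"
    "mtrace A = of_real (\<Sum>i<n. d i)" "mat_fun n f A = U * rdiag n (f \<circ> d) * adj U"
    "mtrace (mat_fun n f A) = of_real (\<Sum>i<n. f (d i))"
proof -
  have "\<exists>U d. unitary n U \<and> A = U * rdiag n d * adj U"
    using assms psd_hermitian by (intro spectral_theorem) (auto simp: psd_def)
  then have "\<exists>B U d. unitary n U \<and> A = U * rdiag n d * adj U \<and> B = U * rdiag n (f \<circ> d) * adj U"
    by blast
  from someI_ex[OF this, folded mat_fun_def]
  obtain U d where U: "unitary n U" "A = U * rdiag n d * adj U"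
    and B: "mat_fun n f A = U * rdiag n (f \<circ> d) * adj U" by blast
  show thesis
    using that[OF U psd_eigenvalue_nonneg[OF assms U] _ B]
      mtrace_unitary_conj[OF U(1), of d] mtrace_unitary_conj[OF U(1), of "f \<circ> d"] U(2) B by simp
qed

section \<open>Frobenius norm, trace norm and entrywise convergence\<close>

definition frob2 :: "complex mat \<Rightarrow> real" where
  "frob2 A = (\<Sum>i<dim_row A. \<Sum>j<dim_col A. (cmod (A $$ (i, j)))\<^sup>2)"

lemma mtrace_adj_mult:
  assumes "A \<in> carrier_mat n n"
  shows "mtrace (adj A * A) = of_real (frob2 A)"
proof -
  have "mtrace (adj A * A) = (\<Sum>j<n. (adj A * A) $$ (j, j))"
    using assms by (simp add: mtrace_def)
  also have "\<dots> = (\<Sum>j<n. \<Sum>i<n. of_real ((cmod (A $$ (i, j)))\<^sup>2))"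
  proof (rule sum.cong[OF refl])
    fix j assume j: "j \<in> {..<n}"
    then have j: "j < n" by simp
    show "(adj A * A) $$ (j, j) = (\<Sum>i<n. of_real ((cmod (A $$ (i, j)))\<^sup>2))"
      unfolding mat_mult_entry[OF adj_carrier[OF assms] assms j j] complex_norm_square
      using assms j by (intro sum.cong) auto
  qed
  also have "\<dots> = of_real (\<Sum>i<n. \<Sum>j<n. (cmod (A $$ (i, j)))\<^sup>2)"
    by (subst sum.swap) simp
  finally show ?thesis using assms by (simp add: frob2_def)
qed

lemma cmod_entry_le_frob2:
  assumes "A \<in> carrier_mat n n" "i < n" "j < n"
  shows "(cmod (A $$ (i, j)))\<^sup>2 \<le> frob2 A"
proof -
  have "(cmod (A $$ (i, j)))\<^sup>2 \<le> (\<Sum>j<n. (cmod (A $$ (i, j)))\<^sup>2)"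
    using assms by (intro member_le_sum) auto
  also have "\<dots> \<le> (\<Sum>i<n. \<Sum>j<n. (cmod (A $$ (i, j)))\<^sup>2)"
    using assms by (intro member_le_sum[of i "{..<n}" "\<lambda>i. \<Sum>j<n. (cmod (A $$ (i, j)))\<^sup>2"]) (auto intro: sum_nonneg)
  finally show ?thesis using assms by (simp add: frob2_def)
qed

text \<open>The quadratic form at \<open>v\<close> is the squared norm of
  \<open>A *\<^sub>v v\<close>. This makes the square root in \<open>trace_norm\<close> accessible
  through \<open>mtrace_mat_fun\<close>.\<close>

lemma psd_adj_mult:
  assumes A: "A \<in> carrier_mat n n"
  shows "psd n (adj A * A)"
  unfolding psd_def
proof (intro conjI ballI)
  show "adj A * A \<in> carrier_mat n n" using A by simp
  fix v :: "complex vec" assume v: "v \<in> carrier_vec n"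
  have Av: "A *\<^sub>v v \<in> carrier_vec n" using A v by simp
  have "cinner v ((adj A * A) *\<^sub>v v) = cinner v (adj A *\<^sub>v (A *\<^sub>v v))"
    using A v by (simp add: assoc_mult_mat_vec[of _ n n _ n])
  also have "\<dots> = (\<Sum>i<n. cnj (v $ i) * (\<Sum>k<n. cnj (A $$ (k, i)) * (A *\<^sub>v v) $ k))"
  proof -
    have "(adj A *\<^sub>v (A *\<^sub>v v)) $ i = (\<Sum>k<n. cnj (A $$ (k, i)) * (A *\<^sub>v v) $ k)" if i: "i < n" for i
      unfolding mat_vec_entry[OF adj_carrier[OF A] Av i] using A i by (intro sum.cong) auto
    then show ?thesis using v by (simp add: cinner_def)
  qed
  also have "\<dots> = (\<Sum>k<n. \<Sum>i<n. cnj (A $$ (k, i) * v $ i) * (A *\<^sub>v v) $ k)"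
    unfolding sum_distrib_left by (subst sum.swap) (simp add: mult_ac)
  also have "\<dots> = (\<Sum>k<n. cnj ((A *\<^sub>v v) $ k) * (A *\<^sub>v v) $ k)"
  proof (rule sum.cong[OF refl])
    fix k assume "k \<in> {..<n}"
    then have k: "k < n" by simp
    show "(\<Sum>i<n. cnj (A $$ (k, i) * v $ i) * (A *\<^sub>v v) $ k) = cnj ((A *\<^sub>v v) $ k) * (A *\<^sub>v v) $ k"
      unfolding mat_vec_entry[OF A v k] cnj_sum sum_distrib_right ..
  qed
  also have "\<dots> = of_real (\<Sum>k<n. (cmod ((A *\<^sub>v v) $ k))\<^sup>2)"
    unfolding of_real_sum complex_norm_square by (simp only: mult.commute)
  finally show "\<exists>r\<ge>0. cinner v ((adj A * A) *\<^sub>v v) = of_real r"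
    by (metis (no_types, lifting) sum_nonneg zero_le_power2)
qed

text \<open>Let \<open>s\<close> be the eigenvalues of \<open>adj A * A\<close>. The trace norm is
  the sum of the \<open>sqrt (s i)\<close> and \<open>frob2 A\<close> the sum of the
  \<open>s i\<close>. Each \<open>sqrt (s i)\<close> is at most the whole trace norm, which gives
  the lower bound on it, and at most \<open>sqrt (frob2 A)\<close>, which gives the upper
  one.\<close>

lemma trace_norm_bounds:
  assumes A: "A \<in> carrier_mat n n"
  shows "0 \<le> trace_norm n A" "frob2 A \<le> (trace_norm n A)\<^sup>2" "trace_norm n A \<le> real n * sqrt (frob2 A)"
proof -
  obtain U s where s: "\<And>i. i < n \<Longrightarrow> 0 \<le> s i" "mtrace (adj A * A) = of_real (\<Sum>i<n. s i)"
    "mtrace (mat_fun n sqrt (adj A * A)) = of_real (\<Sum>i<n. sqrt (s i))"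
    using mtrace_mat_fun[OF psd_adj_mult[OF A], of sqrt] by metis
  have tn: "trace_norm n A = (\<Sum>i<n. sqrt (s i))"
    unfolding trace_norm_def s(3) by simp
  have fr: "frob2 A = (\<Sum>i<n. s i)"
    using s(2) mtrace_adj_mult[OF A] by (metis of_real_eq_iff)
  show nn: "0 \<le> trace_norm n A" unfolding tn by (intro sum_nonneg) (auto intro: s)
  have le: "sqrt (s i) \<le> (\<Sum>i<n. sqrt (s i))" if "i < n" for i
    using that by (intro member_le_sum[of i "{..<n}" "\<lambda>i. sqrt (s i)"]) (auto intro: s)
  have "frob2 A = (\<Sum>i<n. sqrt (s i) * sqrt (s i))"
    unfolding fr using s(1) by (intro sum.cong) auto
  also have "\<dots> \<le> (\<Sum>i<n. sqrt (s i) * (\<Sum>i<n. sqrt (s i)))"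
    by (intro sum_mono mult_left_mono) (auto intro: s le)
  finally show "frob2 A \<le> (trace_norm n A)\<^sup>2"
    by (simp add: tn power2_eq_square sum_distrib_right)
  have "sqrt (s i) \<le> sqrt (frob2 A)" if "i < n" for i
    unfolding fr using that by (intro real_sqrt_le_mono member_le_sum) (auto intro: s)
  then have "trace_norm n A \<le> (\<Sum>i<n. sqrt (frob2 A))"
    unfolding tn by (intro sum_mono) auto
  then show "trace_norm n A \<le> real n * sqrt (frob2 A)" by simp
qed

definition entrywise_tendsto :: "nat \<Rightarrow> (nat \<Rightarrow> complex mat) \<Rightarrow> complex mat \<Rightarrow> bool" where
  "entrywise_tendsto n X A \<longleftrightarrow> (\<forall>i<n. \<forall>j<n. (\<lambda>m. X m $$ (i, j)) \<longlonglongrightarrow> A $$ (i, j))"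

text \<open>The trace norm lies between the modulus of every single entry and \<open>n\<close> times
  the Frobenius norm. All later limit arguments can thus be carried out on entries.\<close>

lemma entrywise_tendsto_iff_trace_norm:
  assumes X: "\<And>m. X m \<in> carrier_mat n n" and A: "A \<in> carrier_mat n n"
  shows "entrywise_tendsto n X A \<longleftrightarrow> (\<lambda>m. trace_norm n (X m - A)) \<longlonglongrightarrow> 0"
proof
  have XA: "X m - A \<in> carrier_mat n n" for m using X[of m] A by auto
  have entry: "(X m - A) $$ (i, j) = X m $$ (i, j) - A $$ (i, j)" if "i < n" "j < n" for i j m
    using that A X[of m] by auto
  assume L: "entrywise_tendsto n X A"
  have "(\<lambda>m. real n * sqrt (\<Sum>i<n. \<Sum>j<n. (cmod (X m $$ (i, j) - A $$ (i, j)))\<^sup>2))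
      \<longlonglongrightarrow> real n * sqrt (\<Sum>i<n. \<Sum>j<n. (cmod (A $$ (i, j) - A $$ (i, j)))\<^sup>2)"
    using L unfolding entrywise_tendsto_def by (intro tendsto_intros) auto
  moreover have "frob2 (X m - A) = (\<Sum>i<n. \<Sum>j<n. (cmod (X m $$ (i, j) - A $$ (i, j)))\<^sup>2)" for m
    using A by (simp add: frob2_def entry)
  ultimately have upper: "(\<lambda>m. real n * sqrt (frob2 (X m - A))) \<longlonglongrightarrow> 0" by simp
  show "(\<lambda>m. trace_norm n (X m - A)) \<longlonglongrightarrow> 0"
    by (rule tendsto_sandwich[OF _ _ tendsto_const upper])
      (auto intro!: always_eventually trace_norm_bounds XA)
next
  have XA: "X m - A \<in> carrier_mat n n" for m using X[of m] A by auto
  assume R: "(\<lambda>m. trace_norm n (X m - A)) \<longlonglongrightarrow> 0"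
  have "(\<lambda>m. X m $$ (i, j) - A $$ (i, j)) \<longlonglongrightarrow> 0" if ij: "i < n" "j < n" for i j
  proof (rule Lim_null_comparison[OF _ R], rule always_eventually, rule allI)
    fix m
    have "(cmod ((X m - A) $$ (i, j)))\<^sup>2 \<le> (trace_norm n (X m - A))\<^sup>2"
      using cmod_entry_le_frob2[OF XA ij, of m] trace_norm_bounds(2)[OF XA, of m] by linarith
    then have "cmod ((X m - A) $$ (i, j)) \<le> trace_norm n (X m - A)"
      by (rule power2_le_imp_le) (rule trace_norm_bounds(1)[OF XA])
    then show "norm (X m $$ (i, j) - A $$ (i, j)) \<le> trace_norm n (X m - A)"
      using ij A X[of m] by simp
  qed
  then show "entrywise_tendsto n X A"
    unfolding entrywise_tendsto_def by (auto intro: LIM_zero_cancel)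
qed

subsection \<open>Continuity of the relative entropy\<close>

lemma entrywise_tendsto_mult:
  assumes X: "\<And>m. X m \<in> carrier_mat n n" "A \<in> carrier_mat n n"
    and Y: "\<And>m. Y m \<in> carrier_mat n n" "B \<in> carrier_mat n n"
    and lim: "entrywise_tendsto n X A" "entrywise_tendsto n Y B"
  shows "entrywise_tendsto n (\<lambda>m. X m * Y m) (A * B)"
  unfolding entrywise_tendsto_def
proof (intro allI impI)
  fix i j assume ij: "i < n" "j < n"
  show "(\<lambda>m. (X m * Y m) $$ (i, j)) \<longlonglongrightarrow> (A * B) $$ (i, j)"
    unfolding mat_mult_entry[OF X(1) Y(1) ij] mat_mult_entry[OF X(2) Y(2) ij]
    using lim ij unfolding entrywise_tendsto_def by (intro tendsto_intros) auto
qed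

lemma entrywise_tendsto_const: "entrywise_tendsto n (\<lambda>_. A) A"
  by (simp add: entrywise_tendsto_def)

lemma entrywise_tendsto_pow:
  assumes X: "\<And>m. X m \<in> carrier_mat n n" and A: "A \<in> carrier_mat n n"
    and lim: "entrywise_tendsto n X A"
  shows "entrywise_tendsto n (\<lambda>m. X m ^\<^sub>m k) (A ^\<^sub>m k)"
proof (induction k)
  case 0
  have "dim_row (X m) = n" for m using X[of m] by simp
  then show ?case using A entrywise_tendsto_const by simp
next
  case (Suc k)
  then show ?case
    using X A lim pow_carrier_mat[OF A] pow_carrier_mat[OF X] by (auto intro: entrywise_tendsto_mult)
qed

lemma tendsto_mtrace:
  assumes X: "\<And>m. X m \<in> carrier_mat n n" and A: "A \<in> carrier_mat n n"
    and lim: "entrywise_tendsto n X A"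
  shows "(\<lambda>m. mtrace (X m)) \<longlonglongrightarrow> mtrace A"
proof -
  have "dim_row (X m) = n" for m using X[of m] by simp
  then show ?thesis
    using lim A unfolding mtrace_def entrywise_tendsto_def by (auto intro!: tendsto_sum)
qed

lemma unitary_conj_pow:
  assumes U: "unitary n U"
  shows "(U * rdiag n d * adj U) ^\<^sub>m k = U * rdiag n (\<lambda>i. d i ^ k) * adj U"
proof (induction k)
  case 0
  have "rdiag n (\<lambda>i. d i ^ 0) = 1\<^sub>m n" by (rule eq_matI) auto
  then show ?case using unitaryD[OF U] by simp
next
  case (Suc k)
  note UD = unitaryD[OF U]
  have dd: "rdiag n (\<lambda>i. d i ^ k) * rdiag n d = rdiag n (\<lambda>i. d i ^ Suc k)"
  proof (rule eq_matI)
    fix i j assume "i < dim_row (rdiag n (\<lambda>i. d i ^ Suc k))" "j < dim_col (rdiag n (\<lambda>i. d i ^ Suc k))"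
    then have ij: "i < n" "j < n" by auto
    show "(rdiag n (\<lambda>i. d i ^ k) * rdiag n d) $$ (i, j) = rdiag n (\<lambda>i. d i ^ Suc k) $$ (i, j)"
      unfolding rdiag_mult_left[OF rdiag_carrier ij] using ij by simp
  qed auto
  have "(U * rdiag n d * adj U) ^\<^sub>m Suc k =
      U * rdiag n (\<lambda>i. d i ^ k) * (adj U * U) * rdiag n d * adj U"
    using Suc UD(1) by (simp add: assoc_mult_square[of _ n])
  also have "\<dots> = U * (rdiag n (\<lambda>i. d i ^ k) * rdiag n d) * adj U"
    using UD by (simp add: assoc_mult_square[of _ n] right_mult_one_mat[of _ n n])
  finally show ?case unfolding dd .
qed

lemma density_spectrum_le_1:
  fixes d :: "nat \<Rightarrow> real"
  assumes "A \<in> density n" "mtrace A = of_real (\<Sum>i<n. d i)" "\<And>i. i < n \<Longrightarrow> 0 \<le> d i" "i < n"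
  shows "d i \<le> 1"
proof -
  have "d i \<le> (\<Sum>i<n. d i)"
    using assms(3,4) by (intro member_le_sum) auto
  also have "\<dots> = 1"
    using assms(1,2) unfolding density_def by (metis (mono_tags, lifting) mem_Collect_eq of_real_eq_1_iff)
  finally show ?thesis .
qed

lemma density_carrier: "A \<in> density n \<Longrightarrow> A \<in> carrier_mat n n"
  by (simp add: density_def psd_def)

lemma density_psd: "A \<in> density n \<Longrightarrow> psd n A"
  by (simp add: density_def)

text \<open>Eigenvalues are not followed along the sequence. For a polynomial \<open>g\<close> close
  to \<open>f\<close> on [0,1], the trace of \<open>g(B)\<close> is a combination of traces of
  powers of \<open>B\<close>, hence continuous in the entries, and it is uniformly close to the
  trace of \<open>f(B)\<close> because density matrices have spectrum in [0,1].\<close>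

lemma tendsto_mtrace_mat_fun:
  fixes f :: "real \<Rightarrow> real"
  assumes f: "continuous_on {0..1} f"
    and X: "\<And>m. X m \<in> density n" and A: "A \<in> density n"
    and lim: "entrywise_tendsto n X A"
  shows "(\<lambda>m. Re (mtrace (mat_fun n f (X m)))) \<longlonglongrightarrow> Re (mtrace (mat_fun n f A))"
proof (rule LIMSEQ_I)
  fix e :: real assume e: "0 < e"
  \<comment> \<open>The error \<open>e'\<close> occurs once for each of the \<open>n\<close>
    eigenvalues and must stay below a third of \<open>e\<close>; the added 1 covers
    \<open>n = 0\<close>.\<close>
  define e' where "e' = e / (3 * (real n + 1))"
  have e': "0 < e'" "real n * e' < e / 3" using e by (auto simp: e'_def field_simps)
  obtain g where g: "real_polynomial_function g" "\<And>x. x \<in> {0..1} \<Longrightarrow> \<bar>f x - g x\<bar> < e'"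
    using Stone_Weierstrass_real_polynomial_function[OF compact_Icc f e'(1)] by blast
  then obtain a K where gs: "g = (\<lambda>x. \<Sum>k\<le>K. a k * x ^ k)"
    unfolding real_polynomial_function_iff_sum by blast
  define T where "T B = (\<Sum>k\<le>K. a k * Re (mtrace (B ^\<^sub>m k)))" for B
  have approx: "\<bar>Re (mtrace (mat_fun n f B)) - T B\<bar> < e / 3" if B: "B \<in> density n" for B
  proof -
    obtain U d where U: "unitary n U" and B_eq: "B = U * rdiag n d * adj U"
      and d: "\<And>i. i < n \<Longrightarrow> 0 \<le> d i" "mtrace B = of_real (\<Sum>i<n. d i)"
        "mtrace (mat_fun n f B) = of_real (\<Sum>i<n. f (d i))"
      using mtrace_mat_fun[OF density_psd[OF B], of f] by metis
    have "mtrace (B ^\<^sub>m k) = of_real (\<Sum>i<n. d i ^ k)" for k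
      unfolding B_eq unitary_conj_pow[OF U] by (rule mtrace_unitary_conj[OF U])
    then have "T B = (\<Sum>k\<le>K. \<Sum>i<n. a k * d i ^ k)"
      by (simp add: T_def sum_distrib_left)
    also have "\<dots> = (\<Sum>i<n. g (d i))" unfolding gs by (rule sum.swap)
    finally have "\<bar>Re (mtrace (mat_fun n f B)) - T B\<bar> = \<bar>\<Sum>i<n. f (d i) - g (d i)\<bar>"
      by (simp add: d(3) sum_subtractf)
    also have "\<dots> \<le> (\<Sum>i<n. e')"
      using d(1) density_spectrum_le_1[OF B d(2,1)]
      by (intro order.trans[OF sum_abs] sum_mono less_imp_le g(2)) auto
    also have "\<dots> < e / 3" using e' by simp
    finally show ?thesis .
  qed
  have "(\<lambda>m. T (X m)) \<longlonglongrightarrow> T A"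
    unfolding T_def using X A density_carrier lim
    by (intro tendsto_intros tendsto_mtrace[of _ n] entrywise_tendsto_pow pow_carrier_mat) auto
  then obtain M where M: "\<And>m. m \<ge> M \<Longrightarrow> norm (T (X m) - T A) < e / 3"
    using LIMSEQ_D[of "\<lambda>m. T (X m)" "T A" "e / 3"] e by auto
  have "norm (Re (mtrace (mat_fun n f (X m))) - Re (mtrace (mat_fun n f A))) < e" if "m \<ge> M" for m
    using M[OF that] approx[OF X[of m]] approx[OF A] by (simp add: abs_if split: if_splits)
  then show "\<exists>M. \<forall>m\<ge>M. norm (Re (mtrace (mat_fun n f (X m))) - Re (mtrace (mat_fun n f A))) < e"
    by blast
qed

lemma continuous_on_x_ln_x: "continuous_on {0..} (\<lambda>x::real. if x = 0 then 0 else x * ln x)"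
  unfolding continuous_on_def
proof
  let ?f = "\<lambda>x::real. if x = 0 then 0 else x * ln x"
  fix x :: real assume "x \<in> {0..}"
  show "(?f \<longlongrightarrow> ?f x) (at x within {0..})"
  proof (cases "x = 0")
    case True
    have le: "norm (?f y) \<le> 2 * sqrt y" if y: "0 \<le> y" "y < 1" for y
    proof (cases "y = 0")
      case False
      then have y0: "0 < y" using y by simp
      \<comment> \<open>The estimate \<open>ln t \<le> t\<close> at \<open>t = 1 / sqrt y\<close>
        bounds the logarithm by a power weak enough to be absorbed by the factor
        \<open>y\<close>.\<close>
      have "- ln y = 2 * ln (1 / sqrt y)" using y0 by (simp add: ln_div ln_sqrt)
      also have "\<dots> \<le> 2 * (1 / sqrt y)" using y0 by (intro mult_left_mono ln_bound) auto
      finally have "y * (- ln y) \<le> y * (2 * (1 / sqrt y))" using y0 by (intro mult_left_mono) auto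
      also have "\<dots> = 2 * sqrt y" using y0 by (simp add: real_div_sqrt field_simps)
      finally show ?thesis using y y0 by (simp add: abs_mult)
    qed simp
    have "\<forall>\<^sub>F y in at 0 within {0..}. 0 \<le> y \<and> y < (1::real)"
      unfolding eventually_at by (rule exI[of _ 1]) (auto simp: dist_real_def)
    then have bound: "\<forall>\<^sub>F y in at 0 within {0..}. norm (?f y) \<le> 2 * sqrt y"
      by (rule eventually_mono) (rule le, auto)
    have "((\<lambda>y. 2 * sqrt y) \<longlongrightarrow> 2 * sqrt 0) (at 0 within {0..})"
      by (intro tendsto_intros)
    then have "(?f \<longlongrightarrow> 0) (at 0 within {0..})"
      by (intro Lim_null_comparison[OF bound]) simp
    then show ?thesis using True by simp
  next
    case False
    have "?f = (\<lambda>x. x * ln x)" by auto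
    then show ?thesis using False by (auto intro!: tendsto_intros)
  qed
qed

text \<open>The first term is the trace of a continuous function of the state; the second is linear
  in the state, with the fixed matrix \<open>mat_fun n ln \<sigma>\<close> as other factor.\<close>

lemma rel_entropy_tendsto:
  assumes X: "\<And>m. X m \<in> density n" and A: "A \<in> density n"
    and lim: "entrywise_tendsto n X A" and \<sigma>: "psd n \<sigma>"
  shows "(\<lambda>m. rel_entropy n (X m) \<sigma>) \<longlonglongrightarrow> rel_entropy n A \<sigma>"
proof -
  have L: "mat_fun n ln \<sigma> \<in> carrier_mat n n"
    using mtrace_mat_fun[OF \<sigma>, of ln] unitaryD(1) by (metis adj_carrier mult_carrier_square rdiag_carrier)
  have "(\<lambda>m. mtrace (X m * mat_fun n ln \<sigma>)) \<longlonglongrightarrow> mtrace (A * mat_fun n ln \<sigma>)"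
    using X A L density_carrier lim
    by (intro tendsto_mtrace[of _ n] entrywise_tendsto_mult entrywise_tendsto_const) auto
  moreover have "continuous_on {0..1} (\<lambda>x::real. if x = 0 then 0 else x * ln x)"
    by (rule continuous_on_subset[OF continuous_on_x_ln_x]) auto
  ultimately show ?thesis
    unfolding rel_entropy_def minus_complex.sel
    by (intro tendsto_diff tendsto_Re tendsto_mtrace_mat_fun X A lim)
qed

text \<open>If the epsilon-delta condition failed at \<open>A\<close>, states at distance less than
  \<open>1 / (m + 1)\<close> from \<open>A\<close> would form a sequence violating sequential
  continuity.\<close>

lemma tn_continuous_onI:
  assumes "\<And>X A. (\<And>m. X m \<in> density n) \<Longrightarrow> A \<in> density n \<Longrightarrow> entrywise_tendsto n X A \<Longrightarrow>
    (\<lambda>m. S (X m)) \<longlonglongrightarrow> S A"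
  shows "tn_continuous_on n S"
  unfolding tn_continuous_on_def
proof (intro ballI allI impI, rule ccontr)
  fix A and e :: real
  assume A: "A \<in> density n" and e: "0 < e"
    and no: "\<not> (\<exists>d>0. \<forall>\<sigma>\<in>density n. trace_norm n (\<sigma> - A) < d \<longrightarrow> \<bar>S \<sigma> - S A\<bar> < e)"
  have "\<forall>m::nat. \<exists>\<sigma>\<in>density n. trace_norm n (\<sigma> - A) < 1 / (real m + 1) \<and> e \<le> \<bar>S \<sigma> - S A\<bar>"
  proof
    fix m :: nat
    have "0 < 1 / (real m + 1)" by simp
    with no show "\<exists>\<sigma>\<in>density n. trace_norm n (\<sigma> - A) < 1 / (real m + 1) \<and> e \<le> \<bar>S \<sigma> - S A\<bar>"
      by (meson not_less)
  qed
  then obtain X where X: "\<And>m. X m \<in> density n" "\<And>m. trace_norm n (X m - A) < 1 / (real m + 1)"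
      "\<And>m. e \<le> \<bar>S (X m) - S A\<bar>"
    by metis
  have XA: "X m - A \<in> carrier_mat n n" for m
    using density_carrier[OF X(1)[of m]] density_carrier[OF A] by auto
  have upper: "(\<lambda>m. 1 / (real m + 1)) \<longlonglongrightarrow> 0"
    using LIMSEQ_inverse_real_of_nat by (simp add: inverse_eq_divide add.commute)
  have "(\<lambda>m. trace_norm n (X m - A)) \<longlonglongrightarrow> 0"
    by (rule tendsto_sandwich[OF _ _ tendsto_const upper])
      (auto intro!: always_eventually trace_norm_bounds XA less_imp_le[OF X(2)])
  then have "entrywise_tendsto n X A"
    using entrywise_tendsto_iff_trace_norm[of X, OF density_carrier[OF X(1)] density_carrier[OF A]] by blast
  then have "(\<lambda>m. S (X m)) \<longlonglongrightarrow> S A" using assms X(1) A by blast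
  then obtain m where "norm (S (X m) - S A) < e"
    using LIMSEQ_D[OF _ e] by blast
  then show False using X(3)[of m] by simp
qed

lemma tn_continuous_onD:
  assumes S: "tn_continuous_on n S" and X: "\<And>m. X m \<in> density n" and A: "A \<in> density n"
    and lim: "entrywise_tendsto n X A"
  shows "(\<lambda>m. S (X m)) \<longlonglongrightarrow> S A"
proof (rule LIMSEQ_I)
  fix e :: real assume "0 < e"
  then obtain d where d: "0 < d" "\<And>\<sigma>. \<sigma> \<in> density n \<Longrightarrow> trace_norm n (\<sigma> - A) < d \<Longrightarrow> \<bar>S \<sigma> - S A\<bar> < e"
    using S A unfolding tn_continuous_on_def by blast
  have "(\<lambda>m. trace_norm n (X m - A)) \<longlonglongrightarrow> 0"
    using lim entrywise_tendsto_iff_trace_norm[of X, OF density_carrier[OF X] density_carrier[OF A]] by blast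
  from LIMSEQ_D[OF this d(1)] obtain M where "\<And>m. m \<ge> M \<Longrightarrow> norm (trace_norm n (X m - A) - 0) < d"
    by blast
  then have "\<And>m. m \<ge> M \<Longrightarrow> trace_norm n (X m - A) < d"
    by (metis abs_ge_self diff_zero le_less_trans real_norm_def)
  then show "\<exists>M. \<forall>m\<ge>M. norm (S (X m) - S A) < e" using d(2)[OF X] by auto
qed

section \<open>Doubly stochastic weights and the scalar entropy inequality\<close>

lemma unitary_row_sum:
  assumes "unitary n W" "i < n"
  shows "(\<Sum>j<n. (cmod (W $$ (i, j)))\<^sup>2) = 1"
proof -
  note W = unitaryD[OF assms(1)]
  have "complex_of_real (\<Sum>j<n. (cmod (W $$ (i, j)))\<^sup>2) = (\<Sum>j<n. W $$ (i, j) * adj W $$ (j, i))"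
    unfolding of_real_sum complex_norm_square using W(1) assms(2) by (intro sum.cong) auto
  also have "\<dots> = 1"
    unfolding mat_mult_entry[OF W(1) adj_carrier[OF W(1)] assms(2,2), symmetric] W(2)
    using assms(2) by simp
  finally show ?thesis by (metis of_real_eq_1_iff)
qed

text \<open>Columns of \<open>W\<close> are conjugated rows of the unitary \<open>adj W\<close>.
  With \<open>unitary_row_sum\<close>, the squared moduli of the entries form a doubly stochastic
  matrix.\<close>

lemma unitary_col_sum:
  assumes "unitary n W" "j < n"
  shows "(\<Sum>i<n. (cmod (W $$ (i, j)))\<^sup>2) = 1"
  using unitary_row_sum[OF unitary_adj[OF assms(1)] assms(2)] unitaryD(1)[OF assms(1)] assms(2)
  by simp

text \<open>Turns the full-rank hypothesis, given as a nonzero determinant, into nonzero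
  eigenvalues.\<close>

lemma det_rdiag_nonzero:
  assumes "det (rdiag n d) \<noteq> 0" "i < n"
  shows "d i \<noteq> 0"
proof
  assume "d i = 0"
  then have "0 \<in> set (diag_mat (rdiag n d))"
    using assms(2) by (force simp: diag_mat_def)
  moreover have "det (rdiag n d) = prod_list (diag_mat (rdiag n d))"
    by (rule det_upper_triangular[of _ n]) auto
  ultimately show False using assms(1) by (simp add: prod_list_zero_iff)
qed

text \<open>The quantity is the Bregman divergence of \<open>x ln x\<close>. For positive
  \<open>x\<close> it equals \<open>x * (t - 1 - ln t)\<close> with \<open>t = y / x\<close>, and
  \<open>ln t \<le> t - 1\<close> is an equality only at \<open>t = 1\<close>. For
  \<open>x = 0\<close> it is \<open>y\<close>, which is positive.\<close>

lemma entropy_gap: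
  fixes x y :: real
  assumes "0 \<le> x" "0 < y"
  defines "g \<equiv> (if x = 0 then 0 else x * ln x) - x * ln y - x + y"
  shows "0 \<le> g" "g = 0 \<longleftrightarrow> x = y"
proof -
  have "0 \<le> g \<and> (g = 0 \<longleftrightarrow> x = y)"
  proof (cases "x = 0")
    case False
    then have x: "0 < x" using assms by simp
    have g: "g = x * (y / x - 1 - ln (y / x))"
      using x assms(2) by (simp add: g_def ln_div field_simps)
    have "0 \<le> y / x - 1 - ln (y / x)"
      using ln_le_minus_one[of "y / x"] x assms(2) by simp
    moreover have "y / x - 1 - ln (y / x) = 0 \<longleftrightarrow> x = y"
      using ln_eq_minus_one[of "y / x"] x assms(2) by auto
    ultimately show ?thesis using x unfolding g by simp
  qed (use assms in auto)
  then show "0 \<le> g" "g = 0 \<longleftrightarrow> x = y" by auto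
qed

subsection \<open>Klein's inequality and compactness of the state space\<close>

text \<open>By cyclicity of the trace only the overlap \<open>W = adj U * V\<close> of the two
  eigenbases matters: the trace becomes that of
  \<open>rdiag n d * W * rdiag n c * adj W\<close>.\<close>

lemma mtrace_conj_conj:
  assumes U: "unitary n U" and V: "unitary n V"
  shows "mtrace ((U * rdiag n d * adj U) * (V * rdiag n c * adj V)) =
    of_real (\<Sum>i<n. \<Sum>j<n. d i * c j * (cmod ((adj U * V) $$ (i, j)))\<^sup>2)"
proof -
  note UD = unitaryD(1)[OF U] and VD = unitaryD(1)[OF V]
  define W where "W = adj U * V"
  have W: "W \<in> carrier_mat n n" using UD VD by (simp add: W_def)
  have adjW: "adj W = adj V * U" using UD VD by (simp add: W_def adj_mult[of _ n n _ n])
  have "mtrace ((U * rdiag n d * adj U) * (V * rdiag n c * adj V)) =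
      mtrace (U * (rdiag n d * (adj U * V) * rdiag n c * adj V))"
    using UD VD by (simp add: assoc_mult_square[of _ n])
  also have "\<dots> = mtrace (rdiag n d * (adj U * V) * rdiag n c * adj V * U)"
    using UD VD by (intro mtrace_mult_commute[of _ n n]) auto
  also have "\<dots> = mtrace (rdiag n d * (W * rdiag n c * adj W))"
    unfolding adjW using UD VD by (simp add: W_def assoc_mult_square[of _ n])
  also have "\<dots> = (\<Sum>i<n. of_real (d i) * (W * rdiag n c * adj W) $$ (i, i))"
    using W by (auto simp: mtrace_def rdiag_mult_left[of _ n n] simp del: index_mult_mat(1) intro!: sum.cong)
  also have "\<dots> = (\<Sum>i<n. \<Sum>j<n. of_real (d i * c j * (cmod (W $$ (i, j)))\<^sup>2))"
  proof (rule sum.cong[OF refl])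
    fix i assume "i \<in> {..<n}"
    then have i: "i < n" by simp
    have "(W * rdiag n c * adj W) $$ (i, i) = (\<Sum>j<n. (W * rdiag n c) $$ (i, j) * adj W $$ (j, i))"
      by (rule mat_mult_entry[of _ n n _ n]) (use W i in auto)
    also have "\<dots> = (\<Sum>j<n. of_real (c j) * of_real ((cmod (W $$ (i, j)))\<^sup>2))"
      unfolding complex_norm_square using W i
      by (intro sum.cong) (auto simp: rdiag_mult_right[OF W] simp del: index_mult_mat(1))
    finally show "of_real (d i) * (W * rdiag n c * adj W) $$ (i, i) =
        (\<Sum>j<n. of_real (d i * c j * (cmod (W $$ (i, j)))\<^sup>2))"
      by (simp add: sum_distrib_left mult.assoc)
  qed
  finally show ?thesis by (simp add: W_def)
qed

text \<open>Equality means that the overlap \<open>adj U * V\<close> intertwines the two diagonal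
  matrices, which is a condition on each entry. Repeated eigenvalues need no separate treatment in
  this form.\<close>

lemma unitary_conj_eq_iff:
  assumes U: "unitary n U" and V: "unitary n V"
  shows "U * rdiag n d * adj U = V * rdiag n c * adj V \<longleftrightarrow>
    (\<forall>i<n. \<forall>j<n. (adj U * V) $$ (i, j) = 0 \<or> d i = c j)"
proof -
  note UD = unitaryD[OF U] and VD = unitaryD[OF V]
  let ?W = "adj U * V"
  have W: "?W \<in> carrier_mat n n" using UD VD by simp
  have "U * rdiag n d * adj U = V * rdiag n c * adj V \<longleftrightarrow> rdiag n d * ?W = ?W * rdiag n c"
  proof
    assume eq: "U * rdiag n d * adj U = V * rdiag n c * adj V"
    have "rdiag n d * ?W = adj U * U * rdiag n d * ?W"
      using UD by (simp add: left_mult_one_mat[of _ n n])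
    also have "\<dots> = adj U * (U * rdiag n d * adj U) * V"
      using UD(1) VD(1) by (simp add: assoc_mult_square[of _ n])
    also have "\<dots> = ?W * rdiag n c * (adj V * V)"
      unfolding eq using UD(1) VD(1) by (simp add: assoc_mult_square[of _ n])
    finally show "rdiag n d * ?W = ?W * rdiag n c" using VD W by (simp add: right_mult_one_mat[of _ n n])
  next
    assume eq: "rdiag n d * ?W = ?W * rdiag n c"
    have "U * rdiag n d * adj U = U * rdiag n d * (adj U * (V * adj V))"
      using UD VD by (simp add: right_mult_one_mat[of _ n n])
    also have "\<dots> = U * (rdiag n d * ?W) * adj V"
      using UD(1) VD(1) by (simp add: assoc_mult_square[of _ n])
    also have "\<dots> = (U * adj U) * V * rdiag n c * adj V"
      unfolding eq using UD(1) VD(1) by (simp add: assoc_mult_square[of _ n])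
    finally show "U * rdiag n d * adj U = V * rdiag n c * adj V"
      using UD VD by (simp add: left_mult_one_mat[of _ n n])
  qed
  also have "\<dots> \<longleftrightarrow> (\<forall>i<n. \<forall>j<n. (rdiag n d * ?W) $$ (i, j) = (?W * rdiag n c) $$ (i, j))"
    using W by (auto simp: mat_eq_iff simp del: index_mult_mat(1))
  also have "\<dots> \<longleftrightarrow> (\<forall>i<n. \<forall>j<n. ?W $$ (i, j) = 0 \<or> d i = c j)"
    using rdiag_mult_left[OF W] rdiag_mult_right[OF W] by (simp del: index_mult_mat(1))
  finally show ?thesis .
qed

text \<open>The equality case of Klein's inequality. With eigenvalues \<open>d\<close> of \<open>\<rho>\<close>, \<open>\<mu>\<close> of \<open>\<sigma>\<close> and
  overlap matrix \<open>W\<close> of the eigenbases, the weights \<open>\<bar>W\<^sub>i\<^sub>j\<bar>\<^sup>2\<close> are doubly stochastic, so the relative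
  entropy is the sum of \<open>\<bar>W\<^sub>i\<^sub>j\<bar>\<^sup>2 (d\<^sub>i ln d\<^sub>i - d\<^sub>i ln \<mu>\<^sub>j - d\<^sub>i + \<mu>\<^sub>j)\<close>, all of whose terms are nonnegative.\<close>

lemma rel_entropy_eq_0_iff:
  assumes \<rho>: "\<rho> \<in> density n" and \<sigma>: "\<sigma> \<in> density n" and det: "det \<sigma> \<noteq> 0"
  shows "rel_entropy n \<rho> \<sigma> = 0 \<longleftrightarrow> \<rho> = \<sigma>"
proof -
  let ?f = "\<lambda>x::real. if x = 0 then 0 else x * ln x"
  obtain U d where U: "unitary n U" and \<rho>_eq: "\<rho> = U * rdiag n d * adj U"
    and d: "\<And>i. i < n \<Longrightarrow> 0 \<le> d i" "mtrace \<rho> = of_real (\<Sum>i<n. d i)"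
      "mtrace (mat_fun n ?f \<rho>) = of_real (\<Sum>i<n. ?f (d i))"
    using mtrace_mat_fun[OF density_psd[OF \<rho>], of ?f] by blast
  obtain V \<mu> where V: "unitary n V" and \<sigma>_eq: "\<sigma> = V * rdiag n \<mu> * adj V"
    and \<mu>: "\<And>i. i < n \<Longrightarrow> 0 \<le> \<mu> i" "mtrace \<sigma> = of_real (\<Sum>i<n. \<mu> i)"
      "mat_fun n ln \<sigma> = V * rdiag n (ln \<circ> \<mu>) * adj V"
    using mtrace_mat_fun[OF density_psd[OF \<sigma>], of ln] by metis
  have sums: "(\<Sum>i<n. d i) = 1" "(\<Sum>i<n. \<mu> i) = 1"
    using \<rho> \<sigma> d(2) \<mu>(2) unfolding density_def by (metis (mono_tags) mem_Collect_eq of_real_eq_1_iff)+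
  have "det \<sigma> = det V * det (rdiag n \<mu>) * det (adj V)"
    unfolding \<sigma>_eq using unitaryD(1)[OF V] by (simp add: det_mult[of _ n])
  then have \<mu>_pos: "0 < \<mu> j" if "j < n" for j
    using det det_rdiag_nonzero[of n \<mu> j] \<mu>(1)[OF that] that by force
  define P where "P i j = (cmod ((adj U * V) $$ (i, j)))\<^sup>2" for i j
  have UV: "unitary n (adj U * V)" using U V by (intro unitary_mult unitary_adj)
  have row: "(\<Sum>j<n. P i j) = 1" if "i < n" for i
    unfolding P_def by (rule unitary_row_sum[OF UV that])
  have col: "(\<Sum>i<n. P i j) = 1" if "j < n" for j
    unfolding P_def by (rule unitary_col_sum[OF UV that])
  define g where "g i j = ?f (d i) - d i * ln (\<mu> j) - d i + \<mu> j" for i j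
  have g: "0 \<le> g i j" "g i j = 0 \<longleftrightarrow> d i = \<mu> j" if "i < n" "j < n" for i j
    unfolding g_def using entropy_gap[OF d(1) \<mu>_pos] that by auto
  have "rel_entropy n \<rho> \<sigma> = (\<Sum>i<n. ?f (d i)) - (\<Sum>i<n. \<Sum>j<n. d i * ln (\<mu> j) * P i j)"
    unfolding rel_entropy_def d(3) \<mu>(3) unfolding \<rho>_eq mtrace_conj_conj[OF U V] by (simp add: P_def)
  \<comment> \<open>The two sums added here cancel, since both traces are 1; they complete each
    summand to the nonnegative expression \<open>g\<close>.\<close>
  also have "\<dots> = (\<Sum>i<n. \<Sum>j<n. ?f (d i) * P i j) - (\<Sum>i<n. \<Sum>j<n. d i * ln (\<mu> j) * P i j)
      - (\<Sum>i<n. \<Sum>j<n. d i * P i j) + (\<Sum>i<n. \<Sum>j<n. \<mu> j * P i j)"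
  proof -
    have "(\<Sum>i<n. \<Sum>j<n. h i * P i j) = (\<Sum>i<n. h i)" for h
      by (simp add: row flip: sum_distrib_left)
    moreover have "(\<Sum>i<n. \<Sum>j<n. \<mu> j * P i j) = (\<Sum>j<n. \<mu> j)"
      by (subst sum.swap) (simp add: col flip: sum_distrib_left)
    ultimately show ?thesis using sums by simp
  qed
  also have "\<dots> = (\<Sum>i<n. \<Sum>j<n. P i j * g i j)"
    unfolding sum_subtractf[symmetric] sum.distrib[symmetric] g_def
    by (intro sum.cong refl) (simp add: algebra_simps)
  finally have S: "rel_entropy n \<rho> \<sigma> = (\<Sum>i<n. \<Sum>j<n. P i j * g i j)" .
  have nn: "0 \<le> P i j * g i j" if "i < n" "j < n" for i j
    using g(1)[OF that] by (simp add: P_def)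
  have "rel_entropy n \<rho> \<sigma> = 0 \<longleftrightarrow> (\<forall>i<n. \<forall>j<n. P i j * g i j = 0)"
  proof -
    have "(\<Sum>j<n. P i j * g i j) = 0 \<longleftrightarrow> (\<forall>j<n. P i j * g i j = 0)" if "i < n" for i
      using nn that by (subst sum_nonneg_eq_0_iff) auto
    moreover have "(\<Sum>i<n. \<Sum>j<n. P i j * g i j) = 0 \<longleftrightarrow> (\<forall>i<n. (\<Sum>j<n. P i j * g i j) = 0)"
      using nn by (subst sum_nonneg_eq_0_iff) (auto intro!: sum_nonneg)
    ultimately show ?thesis unfolding S by blast
  qed
  \<comment> \<open>A product vanishes when the overlap entry does or when the eigenvalues agree:
    exactly the criterion of \<open>unitary_conj_eq_iff\<close>.\<close>
  also have "\<dots> \<longleftrightarrow> (\<forall>i<n. \<forall>j<n. (adj U * V) $$ (i, j) = 0 \<or> d i = \<mu> j)"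
    using g(2) by (simp add: P_def del: index_mult_mat(1))
  also have "\<dots> \<longleftrightarrow> \<rho> = \<sigma>"
    unfolding \<rho>_eq \<sigma>_eq by (rule unitary_conj_eq_iff[OF U V, symmetric])
  finally show ?thesis .
qed

section \<open>Compactness of the set of density matrices\<close>

lemma density_entry_le_1:
  assumes A: "A \<in> density n" and ij: "i < n" "j < n"
  shows "cmod (A $$ (i, j)) \<le> 1"
proof -
  obtain U d where U: "unitary n U" and A_eq: "A = U * rdiag n d * adj U"
    and d: "\<And>i. i < n \<Longrightarrow> 0 \<le> d i" "mtrace A = of_real (\<Sum>i<n. d i)"
    using mtrace_mat_fun[OF density_psd[OF A]] by metis
  note Ac = density_carrier[OF A]
  \<comment> \<open>For Hermitian \<open>A\<close> the squared Frobenius norm is the trace of the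
    square, i.e. the sum of the squared eigenvalues. These lie in [0,1], so it is at most the trace,
    which is 1.\<close>
  have "complex_of_real (frob2 A) = mtrace (A ^\<^sub>m 2)"
    using mtrace_adj_mult[OF Ac] psd_hermitian[OF density_psd[OF A]] Ac by (simp add: numeral_2_eq_2)
  also have "\<dots> = of_real (\<Sum>i<n. d i ^ 2)"
    unfolding A_eq unitary_conj_pow[OF U] by (rule mtrace_unitary_conj[OF U])
  finally have "frob2 A = (\<Sum>i<n. d i ^ 2)" by (metis of_real_eq_iff)
  also have "\<dots> \<le> (\<Sum>i<n. d i)"
    using d(1) density_spectrum_le_1[OF A d(2,1)]
    by (intro sum_mono) (auto simp: power2_eq_square intro: mult_left_le)
  also have "\<dots> = 1"
    using A d(2) unfolding density_def by (metis (mono_tags) mem_Collect_eq of_real_eq_1_iff)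
  finally have "(cmod (A $$ (i, j)))\<^sup>2 \<le> 1\<^sup>2"
    using cmod_entry_le_frob2[OF Ac ij] by simp
  then show ?thesis by (rule power2_le_imp_le) simp
qed

text \<open>Compactness of the closed unit disc is applied to one index after another, each time
  refining the subsequence already found.\<close>

lemma finite_family_convergent_subseq:
  fixes x :: "nat \<Rightarrow> 'i \<Rightarrow> complex"
  assumes "finite I" "\<And>m i. i \<in> I \<Longrightarrow> cmod (x m i) \<le> 1"
  shows "\<exists>r l. strict_mono (r :: nat \<Rightarrow> nat) \<and> (\<forall>i\<in>I. (\<lambda>m. x (r m) i) \<longlonglongrightarrow> l i)"
  using assms
proof (induction I)
  case empty
  show ?case using strict_mono_id by blast
next
  case (insert k I)
  from insert.IH insert.prems obtain r l where r: "strict_mono (r :: nat \<Rightarrow> nat)" "\<And>i. i \<in> I \<Longrightarrow> (\<lambda>m. x (r m) i) \<longlonglongrightarrow> l i"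
    by blast
  have "\<forall>m. x (r m) k \<in> cball 0 1" using insert.prems by simp
  then obtain z s where s: "strict_mono (s :: nat \<Rightarrow> nat)" "((\<lambda>m. x (r m) k) \<circ> s) \<longlonglongrightarrow> z"
    using compact_cball[of "0::complex" 1] unfolding compact_def by metis
  have "(\<lambda>m. x ((r \<circ> s) m) i) \<longlonglongrightarrow> (l(k := z)) i" if "i \<in> insert k I" for i
    using s(2) LIMSEQ_subseq_LIMSEQ[OF r(2) s(1), of i] that by (auto simp: o_def)
  then show ?case using strict_mono_o[OF r(1) s(1)] by blast
qed

text \<open>For fixed \<open>v\<close> the quadratic form is continuous in the entries, and being
  real, nonnegative or of trace one is a closed condition.\<close>

lemma density_closed:
  assumes X: "\<And>m. X m \<in> density n" and A: "A \<in> carrier_mat n n" and lim: "entrywise_tendsto n X A"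
  shows "A \<in> density n"
proof -
  have "\<exists>r\<ge>0. cinner v (A *\<^sub>v v) = complex_of_real r" if v: "v \<in> carrier_vec n" for v
  proof -
    have L: "(\<lambda>m. cinner v (X m *\<^sub>v v)) \<longlonglongrightarrow> cinner v (A *\<^sub>v v)"
      unfolding cinner_mult_mat_vec[OF A v] cinner_mult_mat_vec[OF density_carrier[OF X] v]
      using lim unfolding entrywise_tendsto_def by (intro tendsto_intros) auto
    have *: "\<exists>r\<ge>0. cinner v (X m *\<^sub>v v) = complex_of_real r" for m
      using density_psd[OF X[of m]] v by (auto simp: psd_def)
    have "0 \<le> Re (cinner v (X m *\<^sub>v v))" "Im (cinner v (X m *\<^sub>v v)) = 0" for m
      using *[of m] by auto
    then have "0 \<le> Re (cinner v (A *\<^sub>v v))" "Im (cinner v (A *\<^sub>v v)) = 0"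
      using tendsto_Re[OF L] tendsto_Im[OF L]
      by (auto intro: LIMSEQ_le_const LIMSEQ_unique[OF _ tendsto_const])
    then show ?thesis by (intro exI[of _ "Re (cinner v (A *\<^sub>v v))"]) (simp add: complex_eq_iff)
  qed
  moreover have "mtrace A = 1"
  proof -
    have "mtrace (X m) = 1" for m using X[of m] by (simp add: density_def)
    then show ?thesis
      using tendsto_mtrace[of X, OF density_carrier[OF X] A lim] by (simp add: LIMSEQ_const_iff)
  qed
  ultimately show ?thesis using A by (simp add: density_def psd_def)
qed

lemma density_compact:
  assumes X: "\<And>m. X m \<in> density n"
  obtains r A where "strict_mono (r :: nat \<Rightarrow> nat)" "A \<in> density n" "entrywise_tendsto n (\<lambda>m. X (r m)) A"
proof -
  obtain r l where r: "strict_mono (r :: nat \<Rightarrow> nat)"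
    and l: "\<forall>p\<in>{..<n} \<times> {..<n}. (\<lambda>m. X (r m) $$ p) \<longlonglongrightarrow> l p"
    using finite_family_convergent_subseq[of "{..<n} \<times> {..<n}" "\<lambda>m p. X m $$ p"]
      density_entry_le_1[OF X] by auto
  have lim: "entrywise_tendsto n (\<lambda>m. X (r m)) (mat n n l)"
    using l by (simp add: entrywise_tendsto_def)
  then have "mat n n l \<in> density n" by (intro density_closed[OF X]) auto
  then show thesis using that r lim by blast
qed

subsection \<open>Channels, mixing and Lyapunov functions\<close>

text \<open>Complete positivity at block size 1 is plain positivity, because a one-block matrix is
  the block itself.\<close>

lemma quantum_channel_density:
  assumes \<tau>: "quantum_channel n \<tau>" and A: "A \<in> density n"
  shows "\<tau> A \<in> density n"
proof -
  have Ac: "A \<in> carrier_mat n n" using A by (rule density_carrier)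
  have \<tau>c: "\<tau> A \<in> carrier_mat n n" using \<tau> Ac by (simp add: quantum_channel_def)
  have block1: "block_mat 1 n (\<lambda>_ _. B) = B" if "B \<in> carrier_mat n n" for B
    by (rule eq_matI) (use that in \<open>auto simp: block_mat_def\<close>)
  have "psd (1 * n) (block_mat 1 n (\<lambda>_ _. \<tau> A))"
  proof -
    have "psd (k * n) (block_mat k n M) \<Longrightarrow> psd (k * n) (block_mat k n (\<lambda>i j. \<tau> (M i j)))"
      if "\<And>i j. M i j \<in> carrier_mat n n" for k M
      using \<tau> that unfolding quantum_channel_def by blast
    from this[of "\<lambda>_ _. A" 1] show ?thesis
      using Ac density_psd[OF A] by (simp add: block1[OF Ac, simplified])
  qed
  then show ?thesis
    using \<tau> A Ac by (simp add: block1[OF \<tau>c, simplified] density_def quantum_channel_def)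
qed

text \<open>Expansion in the matrix units \<open>E p\<close>. It shows that each entry of
  \<open>\<tau> A\<close> is a fixed linear form in the entries of \<open>A\<close>, whence the
  continuity of \<open>\<tau>\<close>.\<close>

lemma quantum_channel_entries:
  assumes \<tau>: "quantum_channel n \<tau>" and A: "A \<in> carrier_mat n n" and kl: "k < n" "l < n"
  defines "E \<equiv> \<lambda>p. mat n n (\<lambda>q. if q = p then 1 else 0)"
  shows "\<tau> A $$ (k, l) = (\<Sum>p\<in>{..<n} \<times> {..<n}. A $$ p * \<tau> (E p) $$ (k, l))"
proof -
  have add: "\<tau> (B + C) = \<tau> B + \<tau> C" if "B \<in> carrier_mat n n" "C \<in> carrier_mat n n" for B C
    using \<tau> that by (simp add: quantum_channel_def)
  have smult: "\<tau> (c \<cdot>\<^sub>m B) = c \<cdot>\<^sub>m \<tau> B" if "B \<in> carrier_mat n n" for c B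
    using \<tau> that by (simp add: quantum_channel_def)
  have closed: "\<tau> B \<in> carrier_mat n n" if "B \<in> carrier_mat n n" for B
    using \<tau> that by (simp add: quantum_channel_def)
  have E: "E p \<in> carrier_mat n n" for p by (simp add: E_def)
  \<comment> \<open>Additivity is available for two summands only, so the entries of
    \<open>A\<close> are switched on one at a time, by induction on the set \<open>S\<close> of
    positions kept.\<close>
  have "\<tau> (mat n n (\<lambda>q. if q \<in> S then A $$ q else 0)) $$ (k, l) = (\<Sum>p\<in>S. A $$ p * \<tau> (E p) $$ (k, l))"
    if "finite S" for S
    using that
  proof induction
    case empty
    \<comment> \<open>Writing the zero matrix as a zero multiple lets homogeneity give its
      image.\<close>
    have "mat n n (\<lambda>q. if q \<in> {} then A $$ q else 0) = 0 \<cdot>\<^sub>m E (0, 0)"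
      by (rule eq_matI) (auto simp: E_def)
    then show ?case using smult[OF E, of 0] closed[OF E, of "(0, 0)"] kl by simp
  next
    case (insert p S)
    let ?M = "\<lambda>S. mat n n (\<lambda>q. if q \<in> S then A $$ q else 0)"
    have "?M (insert p S) = ?M S + A $$ p \<cdot>\<^sub>m E p"
      by (rule eq_matI) (use insert.hyps in \<open>auto simp: E_def\<close>)
    then have "\<tau> (?M (insert p S)) = \<tau> (?M S) + A $$ p \<cdot>\<^sub>m \<tau> (E p)"
      using E smult[OF E] by (simp add: add)
    then show ?case using insert closed[OF E, of p] kl by simp
  qed
  from this[of "{..<n} \<times> {..<n}"]
  have "\<tau> (mat n n (\<lambda>q. if q \<in> {..<n} \<times> {..<n} then A $$ q else 0)) $$ (k, l) =
    (\<Sum>p\<in>{..<n} \<times> {..<n}. A $$ p * \<tau> (E p) $$ (k, l))" by simp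
  moreover have "mat n n (\<lambda>q. if q \<in> {..<n} \<times> {..<n} then A $$ q else 0) = A"
    by (rule eq_matI) (use A in auto)
  ultimately show ?thesis by simp
qed

lemma quantum_channel_tendsto:
  assumes \<tau>: "quantum_channel n \<tau>" and X: "\<And>m. X m \<in> carrier_mat n n" and A: "A \<in> carrier_mat n n"
    and lim: "entrywise_tendsto n X A"
  shows "entrywise_tendsto n (\<lambda>m. \<tau> (X m)) (\<tau> A)"
  unfolding entrywise_tendsto_def
proof (intro allI impI)
  fix k l assume kl: "k < n" "l < n"
  show "(\<lambda>m. \<tau> (X m) $$ (k, l)) \<longlonglongrightarrow> \<tau> A $$ (k, l)"
    unfolding quantum_channel_entries[OF \<tau> X kl] quantum_channel_entries[OF \<tau> A kl]
    using lim unfolding entrywise_tendsto_def by (intro tendsto_intros) auto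
qed

lemma quantum_channel_pow_density:
  assumes "quantum_channel n \<tau>" "A \<in> density n"
  shows "(\<tau> ^^ k) A \<in> density n"
  by (induction k) (use assms quantum_channel_density in auto)

lemma quantum_channel_pow_tendsto:
  assumes \<tau>: "quantum_channel n \<tau>" and X: "\<And>m. X m \<in> density n" and A: "A \<in> density n"
    and lim: "entrywise_tendsto n X A"
  shows "entrywise_tendsto n (\<lambda>m. (\<tau> ^^ k) (X m)) ((\<tau> ^^ k) A)"
proof (induction k)
  case (Suc k)
  then show ?case
    using quantum_channel_tendsto[OF \<tau> density_carrier[OF quantum_channel_pow_density[OF \<tau> X]]
        density_carrier[OF quantum_channel_pow_density[OF \<tau> A]]] by simp
qed (use lim in simp)

text \<open>The limit state in \<open>mixing\<close> is unspecified; the constant orbit of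
  \<open>\<rho>s\<close> identifies it as \<open>\<rho>s\<close>.\<close>

lemma mixing_imp_tendsto_fixed_point:
  assumes \<tau>: "quantum_channel n \<tau>" and \<rho>s: "\<rho>s \<in> density n" "\<tau> \<rho>s = \<rho>s"
    and mix: "mixing n \<tau>" and \<rho>: "\<rho> \<in> density n"
  shows "entrywise_tendsto n (\<lambda>m. (\<tau> ^^ m) \<rho>) \<rho>s"
proof -
  obtain \<rho>0 where \<rho>0: "\<rho>0 \<in> density n"
    and lim: "\<And>\<rho>. \<rho> \<in> density n \<Longrightarrow> (\<lambda>m. trace_norm n ((\<tau> ^^ m) \<rho> - \<rho>0)) \<longlonglongrightarrow> 0"
    using mix unfolding mixing_def by blast
  have conv: "entrywise_tendsto n (\<lambda>m. (\<tau> ^^ m) \<rho>) \<rho>0" if "\<rho> \<in> density n" for \<rho>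
    using lim[OF that] entrywise_tendsto_iff_trace_norm[of "\<lambda>m. (\<tau> ^^ m) \<rho>",
        OF density_carrier[OF quantum_channel_pow_density[OF \<tau> that]] density_carrier[OF \<rho>0]] by blast
  have "(\<tau> ^^ m) \<rho>s = \<rho>s" for m by (induction m) (use \<rho>s(2) in auto)
  with conv[OF \<rho>s(1)] have "entrywise_tendsto n (\<lambda>_. \<rho>s) \<rho>0" by simp
  then have "\<rho>s = \<rho>0"
    using density_carrier[OF \<rho>s(1)] density_carrier[OF \<rho>0]
    by (auto simp: entrywise_tendsto_def LIMSEQ_const_iff mat_eq_iff)
  then show ?thesis using conv[OF \<rho>] by simp
qed

text \<open>A LaSalle-type argument for arbitrary \<open>S\<close>. An orbit not tending to
  \<open>\<rho>s\<close> has a subsequence staying away from it, and by compactness a further one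
  tending to some state \<open>A\<close>. On the orbit of \<open>A\<close> the function
  \<open>S\<close> is constant, so the Lyapunov property gives \<open>A = \<rho>s\<close>, a
  contradiction.\<close>

lemma gen_lyapunov_imp_mixing:
  assumes \<tau>: "quantum_channel n \<tau>" and \<rho>s: "\<rho>s \<in> density n" and S: "gen_lyapunov n \<tau> S \<rho>s"
  shows "mixing n \<tau>"
  unfolding mixing_def
proof (intro bexI[OF _ \<rho>s] ballI, rule ccontr)
  fix \<rho> assume \<rho>: "\<rho> \<in> density n"
  define X where "X m = (\<tau> ^^ m) \<rho>" for m
  have X: "X m \<in> density n" for m unfolding X_def by (rule quantum_channel_pow_density[OF \<tau> \<rho>])
  assume "\<not> (\<lambda>m. trace_norm n ((\<tau> ^^ m) \<rho> - \<rho>s)) \<longlonglongrightarrow> 0"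
  then obtain e where e: "0 < e" and "\<not> (\<forall>\<^sub>F m in sequentially. dist (trace_norm n (X m - \<rho>s)) 0 < e)"
    unfolding tendsto_iff X_def by blast
  then obtain r where r: "strict_mono (r :: nat \<Rightarrow> nat)"
    and far: "\<And>m. \<not> dist (trace_norm n (X (r m) - \<rho>s)) 0 < e"
    using not_eventually_sequentiallyD by blast
  obtain s A where s: "strict_mono (s :: nat \<Rightarrow> nat)" and A: "A \<in> density n"
    and lim: "entrywise_tendsto n (\<lambda>m. X (r (s m))) A"
    using density_compact[of "\<lambda>m. X (r m)"] X by metis
  have rs: "strict_mono (\<lambda>m. r (s m))" using strict_mono_o[OF r s] by (simp add: o_def)
  obtain L where L: "(\<lambda>m. S (X m)) \<longlonglongrightarrow> L"
    using S \<rho> unfolding gen_lyapunov_def X_def convergent_def by blast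
  have const: "S ((\<tau> ^^ k) A) = L" for k
  proof -
    have "(\<lambda>m. S ((\<tau> ^^ k) (X (r (s m))))) \<longlonglongrightarrow> S ((\<tau> ^^ k) A)"
      using S X A lim \<tau> unfolding gen_lyapunov_def
      by (intro tn_continuous_onD[of n] quantum_channel_pow_tendsto quantum_channel_pow_density) auto
    moreover have "(\<lambda>m. S ((\<tau> ^^ k) (X (r (s m))))) \<longlonglongrightarrow> L"
    proof -
      \<comment> \<open>Applying \<open>\<tau> ^^ k\<close> only shifts the indices, so the values
        again form a subsequence of the convergent sequence \<open>S (X m)\<close>.\<close>
      have "strict_mono (\<lambda>m. k + r (s m))" using rs by (simp add: strict_mono_def)
      from LIMSEQ_subseq_LIMSEQ[OF L this] show ?thesis
        by (simp add: X_def o_def funpow_add)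
    qed
    ultimately show ?thesis by (rule LIMSEQ_unique)
  qed
  have "lim (\<lambda>k. S ((\<tau> ^^ k) A)) = S A" using const[of 0] by (simp add: const)
  then have "A = \<rho>s" using S A unfolding gen_lyapunov_def by blast
  then have "(\<lambda>m. trace_norm n (X (r (s m)) - \<rho>s)) \<longlonglongrightarrow> 0"
    using lim entrywise_tendsto_iff_trace_norm[of "\<lambda>m. X (r (s m))" n A,
        OF density_carrier[OF X] density_carrier[OF A]] by simp
  from tendstoD[OF this e] show False
    using far by (auto simp: eventually_sequentially)
qed

theorem mainTheorem11:
  fixes n :: nat and \<tau> :: "complex mat \<Rightarrow> complex mat" and \<rho>s :: "complex mat"
  assumes "quantum_channel n \<tau>"
    and "\<rho>s \<in> density n"
    and "det \<rho>s \<noteq> 0"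
    and "\<tau> \<rho>s = \<rho>s"
  shows "mixing n \<tau> \<longleftrightarrow> gen_lyapunov n \<tau> (\<lambda>\<rho>. rel_entropy n \<rho> \<rho>s) \<rho>s"
proof
  assume mix: "mixing n \<tau>"
  have S: "(\<lambda>m. rel_entropy n (X m) \<rho>s) \<longlonglongrightarrow> rel_entropy n A \<rho>s"
    if "\<And>m. X m \<in> density n" "A \<in> density n" "entrywise_tendsto n X A" for X A
    using rel_entropy_tendsto that density_psd[OF assms(2)] by blast
  \<comment> \<open>The limit of the orbit is \<open>\<rho>s\<close>, whose relative entropy to
    itself is 0.\<close>
  have lim0: "(\<lambda>m. rel_entropy n ((\<tau> ^^ m) \<rho>) \<rho>s) \<longlonglongrightarrow> 0" if "\<rho> \<in> density n" for \<rho>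
    using S[OF quantum_channel_pow_density[OF assms(1) that] assms(2)
        mixing_imp_tendsto_fixed_point[OF assms(1,2,4) mix that]]
      rel_entropy_eq_0_iff[OF assms(2,2,3)] by simp
  show "gen_lyapunov n \<tau> (\<lambda>\<rho>. rel_entropy n \<rho> \<rho>s) \<rho>s"
    unfolding gen_lyapunov_def
  proof (intro conjI ballI impI)
    show "tn_continuous_on n (\<lambda>\<rho>. rel_entropy n \<rho> \<rho>s)" by (rule tn_continuous_onI) (rule S)
    fix \<rho> assume \<rho>: "\<rho> \<in> density n"
    show "convergent (\<lambda>m. rel_entropy n ((\<tau> ^^ m) \<rho>) \<rho>s)"
      using lim0[OF \<rho>] by (auto simp: convergent_def)
    assume "\<rho> \<noteq> \<rho>s"
    \<comment> \<open>The limit is 0, whereas the initial value is nonzero by the equality case of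
      Klein's inequality.\<close>
    then show "lim (\<lambda>m. rel_entropy n ((\<tau> ^^ m) \<rho>) \<rho>s) \<noteq> rel_entropy n \<rho> \<rho>s"
      using limI[OF lim0[OF \<rho>]] rel_entropy_eq_0_iff[OF \<rho> assms(2,3)] by simp
  qed
qed (rule gen_lyapunov_imp_mixing[OF assms(1,2)])

end
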